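(* Let $P$ be a probability measure on $(\Omega,\mathcal F)$ under which the coordinate process $X$ is a nonnegative local martingale with $P(X_0=1)=1$, and let $Q$ be the Föllmer measure of $X$. Suppose that $b:=P(T_0=\mathfrak T)=P(X_\infty>0)$ satisfies $b=0$. Then $$\mathrm dQ(\,\cdot\,|\,T_{1/a}\le T_\infty)=\frac{1}{X_{T_{1/a}}}\,\mathrm dQ\qquad\text{for all }a>1.$$ In particular, there exists a unique probability measure $\widetilde P$ on $(\Omega,\mathcal F)$ such that $\widetilde P|_{\mathcal F_{T_{1/a}}}=Q(\cdot|T_{1/a}<\mathfrak T)|_{\mathcal F_{T_{1/a}}}$ for all $a>1$; in fact, $\widetilde P=P$.
   Context: $\Omega=C_{\mathrm{abs}}$ is the space of functions $\omega:[0,\infty)\to[0,\infty]$ that are absorbed in $0$ and in $\infty$ (once $\omega$ reaches $0$ or $\infty$ it stays there) and that are continuous on $[0,T_\infty(\omega))$, where $T_\infty(\omega)$ is the first hitting time of $\{\infty\}$. $X$ is the coordinate process, $X_t(\omega)=\omega(t)$, and $X_\infty:=\sqrt{\limsup_{t\uparrow\infty}X_t\,\liminf_{t\uparrow\infty}X_t}$ with the convention $\infty\cdot 0:=1$. The filtration is $\mathcal F_t=\sigma(X_s:s\le t)$ and $\mathcal F=\bigvee_{t\ge0}\mathcal F_t$; martingales and local martingales are with respect to this filtration. For $a\in[0,\infty]$, $T_a=\inf\{t\in[0,\infty]:X_t=a\}$ (the time $t=\infty$ is allowed), with $\inf\emptyset:=\mathfrak T$, where $\mathfrak T$ is an extra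 symbol ("time beyond infinity") and the order is extended to $[0,\infty]\cup\{\mathfrak T\}$ by $t<\mathfrak T$ for all $t\in[0,\infty]$. For a stopping time $\tau$, $X^\tau$ is $X$ stopped at $\tau$, $X_\tau$ denotes $X^\tau_\infty$ (with $1/\infty=0$), and $\mathcal F_\tau=\{A\in\mathcal F:A\cap\{\tau\le t\}\in\mathcal F_t\ \forall t\in[0,\infty)\}=\sigma(X^\tau_s:s<\infty)$. Föllmer measure: $Q$ is the unique probability measure on $(\Omega,\mathcal F)$ satisfying $\mathrm dQ|_{\mathcal F_\tau}=X_\tau\,\mathrm dP|_{\mathcal F_\tau}$ for all stopping times $\tau$ for which $X^\tau$ is a uniformly integrable $P$-martingale (its existence is known).
   Formalization: The path space Ω is restricted: if T_∞ is finite then ω(T_∞)=∞, and a path may not tend to 0 as t increases to T_∞>0 and then jump to ∞. Without this, hitting times need not be measurable and uniqueness of the measure fails, e.g. for Brownian motion from 1 stopped at 0. *)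

theory Defs
  imports "HOL-Probability.Probability"
begin

section \<open>Times in \<open>[0,\<infinity>] \<union> {\<TT>}\<close>\<close>

text \<open>\<open>Beyond\<close> is the extra time \<open>\<TT>\<close>, strictly after \<open>Time \<infinity>\<close>.\<close>

datatype xtime = Time ennreal | Beyond

instantiation xtime :: linorder
begin

definition less_eq_xtime :: "xtime \<Rightarrow> xtime \<Rightarrow> bool" where
  "s \<le> t \<longleftrightarrow> (case t of Beyond \<Rightarrow> True
               | Time v \<Rightarrow> (case s of Beyond \<Rightarrow> False | Time u \<Rightarrow> u \<le> v))"

definition less_xtime :: "xtime \<Rightarrow> xtime \<Rightarrow> bool" where
  "s < t \<longleftrightarrow> s \<le> t \<and> \<not> t \<le> (s :: xtime)"

instance
  by standard (auto simp: less_eq_xtime_def less_xtime_def split: xtime.splits)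

end

section \<open>Paths and the coordinate process\<close>

text \<open>A path is a function on \<open>[0,\<infinity>)\<close>; as an element of \<open>real \<Rightarrow> ennreal\<close> it is
  made canonical by requiring it to be extensional on \<open>{0..}\<close>.\<close>

type_synonym path = "real \<Rightarrow> ennreal"

definition ennreal_sqrt :: "ennreal \<Rightarrow> ennreal" where
  "ennreal_sqrt x = (if x = \<infinity> then \<infinity> else ennreal (sqrt (enn2real x)))"

text \<open>The value at time \<open>\<infinity>\<close>, with the convention \<open>\<infinity> \<cdot> 0 = 1\<close> under the square root
  (in \<open>ennreal\<close> that product is \<open>0\<close>).\<close>

definition path_at_inf :: "path \<Rightarrow> ennreal" where
  "path_at_inf \<omega> =
     (let S = Limsup at_top \<omega>; I = Liminf at_top \<omega>
      in ennreal_sqrt (if S = \<infinity> \<and> I = 0 then 1 else S * I))"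

definition X :: "ennreal \<Rightarrow> path \<Rightarrow> ennreal" where
  "X t \<omega> = (if t = \<infinity> then path_at_inf \<omega> else \<omega> (enn2real t))"

definition hitting_time :: "ennreal \<Rightarrow> path \<Rightarrow> xtime" where
  "hitting_time a \<omega> = (if \<exists>t. X t \<omega> = a then Time (Inf {t. X t \<omega> = a}) else Beyond)"

text \<open>The last clause makes precise what reaching and being absorbed mean at the time \<open>T\<^sub>\<infinity>\<close>,
  about which continuity on \<open>[0, T\<^sub>\<infinity>)\<close> is silent. First, \<open>T\<^sub>\<infinity>\<close> is a genuine first hitting
  time: if it is finite then the path is at \<open>\<infinity>\<close> at \<open>T\<^sub>\<infinity>\<close>. Without this the value at \<open>T\<^sub>\<infinity>\<close>
  could be an arbitrary finite number followed by \<open>\<infinity>\<close>, and the hitting times of finite levels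
  would not be measurable. Second, a path that has reached \<open>0\<close> as a left limit is not allowed to
  leave it by jumping to \<open>\<infinity>\<close>. Otherwise a path running continuously into \<open>0\<close> at a time \<open>T\<close>, and
  the path that agrees with it before \<open>T\<close> but is \<open>\<infinity>\<close> from \<open>T\<close> on, would be indistinguishable
  for the sigma-algebras up to the hitting times of all levels \<open>1/a\<close>, so that these would not
  determine a measure. All other jumps to \<open>\<infinity>\<close> are allowed.\<close>

definition C_abs :: "path set" where
  "C_abs = {\<omega> \<in> extensional {0..}.
     (\<forall>s t. 0 \<le> s \<longrightarrow> s \<le> t \<longrightarrow> \<omega> s = 0 \<longrightarrow> \<omega> t = 0) \<and>
     (\<forall>s t. 0 \<le> s \<longrightarrow> s \<le> t \<longrightarrow> \<omega> s = \<infinity> \<longrightarrow> \<omega> t = \<infinity>) \<and>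
     continuous_on {t. 0 \<le> t \<and> Time (ennreal t) < hitting_time \<infinity> \<omega>} \<omega> \<and>
     (\<forall>t. 0 \<le> t \<longrightarrow> hitting_time \<infinity> \<omega> = Time (ennreal t) \<longrightarrow>
        \<omega> t = \<infinity> \<and> (0 < t \<longrightarrow> \<not> (\<omega> \<longlongrightarrow> 0) (at_left t)))}"

section \<open>Filtration and stopping times\<close>

text \<open>As is common in HOL-Probability, a sigma-algebra is represented by a measure of which only
  \<open>space\<close> and \<open>sets\<close> matter.\<close>

definition Filt :: "real \<Rightarrow> path measure" where
  "Filt t = sigma C_abs
     {X (ennreal s) -` B \<inter> C_abs | s B. 0 \<le> s \<and> s \<le> t \<and> B \<in> sets borel}"

definition Filt_inf :: "path measure" where
  "Filt_inf = sigma C_abs (\<Union>t\<in>{0..}. sets (Filt t))"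

text \<open>The constant \<open>stopping_time\<close> of HOL-Probability takes its values in the index set of the
  filtration; here the filtration is indexed by \<open>[0,\<infinity>)\<close> and the values lie in \<open>xtime\<close>.\<close>

definition is_stopping_time :: "(path \<Rightarrow> xtime) \<Rightarrow> bool" where
  "is_stopping_time \<tau> \<longleftrightarrow>
     (\<forall>t\<ge>0. {\<omega> \<in> C_abs. \<tau> \<omega> \<le> Time (ennreal t)} \<in> sets (Filt t))"

text \<open>If \<open>\<tau>\<close> is a stopping time then the generating family is itself a sigma-algebra.\<close>

definition Filt_at :: "(path \<Rightarrow> xtime) \<Rightarrow> path measure" where
  "Filt_at \<tau> = sigma C_abs
     {A \<in> sets Filt_inf. \<forall>t\<ge>0. A \<inter> {\<omega> \<in> C_abs. \<tau> \<omega> \<le> Time (ennreal t)} \<in> sets (Filt t)}"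

fun stop_path :: "xtime \<Rightarrow> path \<Rightarrow> path" where
  "stop_path (Time u) \<omega> = (\<lambda>t\<in>{0..}. X (min (ennreal t) u) \<omega>)"
| "stop_path Beyond \<omega> = \<omega>"

definition stopped :: "(path \<Rightarrow> xtime) \<Rightarrow> real \<Rightarrow> path \<Rightarrow> ennreal" where
  "stopped \<tau> t \<omega> = stop_path (\<tau> \<omega>) \<omega> t"

definition X_at :: "(path \<Rightarrow> xtime) \<Rightarrow> path \<Rightarrow> ennreal" where
  "X_at \<tau> \<omega> = X \<infinity> (stop_path (\<tau> \<omega>) \<omega>)"

section \<open>Nonnegative (local) martingales\<close>

text \<open>Processes indexed by \<open>[0,\<infinity>)\<close> with values in \<open>[0,\<infinity>]\<close>; a martingale is integrable, hence
  almost surely finite at each time.\<close>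

definition is_martingale :: "path measure \<Rightarrow> (real \<Rightarrow> path \<Rightarrow> ennreal) \<Rightarrow> bool" where
  "is_martingale M Y \<longleftrightarrow>
     (\<forall>t\<ge>0. Y t \<in> borel_measurable (Filt t) \<and> (\<integral>\<^sup>+ \<omega>. Y t \<omega> \<partial>M) < \<infinity>) \<and>
     (\<forall>s\<ge>0. \<forall>t\<ge>s. AE \<omega> in M. nn_cond_exp M (Filt s) (Y t) \<omega> = Y s \<omega>)"

definition is_uniformly_integrable :: "path measure \<Rightarrow> (real \<Rightarrow> path \<Rightarrow> ennreal) \<Rightarrow> bool" where
  "is_uniformly_integrable M Y \<longleftrightarrow>
     ((\<lambda>K::real. SUP t\<in>{0..}. \<integral>\<^sup>+ \<omega>. Y t \<omega> * indicator {\<omega>. ennreal K < Y t \<omega>} \<omega> \<partial>M)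
        \<longlongrightarrow> 0) at_top"

text \<open>Localization of \<open>X\<close>. Right-continuity is not repeated: it holds for the paths in
  \<open>C_abs\<close>. The usual subtraction of the initial value is not needed for \<open>X\<^sub>0 = 1\<close>.\<close>

definition X_is_local_martingale :: "path measure \<Rightarrow> bool" where
  "X_is_local_martingale M \<longleftrightarrow>
     (\<exists>\<tau> :: nat \<Rightarrow> path \<Rightarrow> xtime.
        (\<forall>n. is_stopping_time (\<tau> n)) \<and>
        (AE \<omega> in M. mono (\<lambda>n. \<tau> n \<omega>)) \<and>
        (AE \<omega> in M. \<forall>t\<ge>0. \<forall>\<^sub>F n in sequentially. Time (ennreal t) < \<tau> n \<omega>) \<and>
        (\<forall>n. is_martingale M (stopped (\<tau> n))))"

section \<open>The Foellmer measure\<close>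

definition is_Foellmer_measure :: "path measure \<Rightarrow> path measure \<Rightarrow> bool" where
  "is_Foellmer_measure P Q \<longleftrightarrow>
     prob_space Q \<and> sets Q = sets Filt_inf \<and>
     (\<forall>\<tau>. is_stopping_time \<tau> \<longrightarrow> is_martingale P (stopped \<tau>) \<longrightarrow>
          is_uniformly_integrable P (stopped \<tau>) \<longrightarrow>
          restr_to_subalg Q (Filt_at \<tau>) = density (restr_to_subalg P (Filt_at \<tau>)) (X_at \<tau>))"

definition extends_conditioned_measures :: "path measure \<Rightarrow> path measure \<Rightarrow> bool" where
  "extends_conditioned_measures Q R \<longleftrightarrow>
     prob_space R \<and> sets R = sets Filt_inf \<and>
     (\<forall>a::real. 1 < a \<longrightarrow>
        (let T = hitting_time (ennreal (1 / a))
         in restr_to_subalg R (Filt_at T) =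
            restr_to_subalg (uniform_measure Q {\<omega> \<in> space Q. T \<omega> < Beyond}) (Filt_at T)))"

text \<open>The two descriptions of the event whose probability is \<open>b\<close> agree on \<open>C_abs\<close>.\<close>

lemma hitting_time_0_eq_Beyond_iff:
  assumes "\<omega> \<in> C_abs"
  shows "hitting_time 0 \<omega> = Beyond \<longleftrightarrow> 0 < X \<infinity> \<omega>"
proof -
  have "X \<infinity> \<omega> = 0" if t: "X t \<omega> = 0" for t
  proof (cases "t = \<infinity>")
    case False
    with t have z: "\<omega> (enn2real t) = 0" by (simp add: X_def)
    have "\<forall>s\<ge>enn2real t. \<omega> s = 0"
      using assms z enn2real_nonneg[of t] unfolding C_abs_def by blast
    then have ev: "\<forall>\<^sub>F s in at_top. \<omega> s = 0"
      by (auto simp: eventually_at_top_linorder)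
    have "Limsup at_top \<omega> = Limsup at_top (\<lambda>_::real. 0 :: ennreal)"
      by (rule Limsup_eq[OF ev])
    then have "Limsup at_top \<omega> = 0" by (simp add: Limsup_const)
    then show ?thesis by (simp add: X_def path_at_inf_def ennreal_sqrt_def)
  qed (use t in simp)
  then show ?thesis
    by (auto simp: hitting_time_def zero_less_iff_neq_zero)
qed

end

theory Submission
  imports Defs
begin

text \<open>
Let \<open>T\<^sub>c\<close> be the hitting time of \<open>c\<close>. The path \<open>X\<close> starts in \<open>1\<close> almost surely, so \<open>X\<close> stopped at \<open>T\<^sub>d\<close>, or at
\<open>T\<^sub>c \<and> T\<^sub>d\<close>, is bounded by \<open>d\<close> if \<open>d \<ge> 1\<close>. A local martingale that is bounded until a stopping time \<open>\<sigma>\<close> is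
a uniformly integrable martingale when stopped at \<open>\<sigma>\<close> (\<open>bounded_stopped_martingale\<close>). Hence
\<open>dQ = X\<^sub>\<sigma> dP\<close> on the events up to \<open>\<sigma>\<close> for these \<open>\<sigma>\<close>, and everything about \<open>Q\<close> is read off from this.

If \<open>b = 0\<close> then \<open>X\<^sub>\<infinity> = 0\<close> holds \<open>P\<close>-almost surely. For \<open>\<sigma> = T\<^sub>d\<close> the density therefore vanishes where \<open>d\<close> is
not hit, and \<open>Q\<close>-almost every path hits all large levels. Let \<open>c = 1/a < 1\<close>. Where \<open>c\<close> is hit before
\<open>d\<close>, the density for \<open>\<sigma> = T\<^sub>c \<and> T\<^sub>d\<close> is the constant \<open>c\<close>. Letting \<open>d \<rightarrow> \<infinity>\<close> gives \<open>Q(A \<inter> {T\<^sub>c < \<TT>}) = c P(A)\<close>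
for all events \<open>A\<close> up to \<open>T\<^sub>c\<close> (\<open>emeasure_Q_hitting\<close>). So \<open>Q(T\<^sub>c < \<TT>) = c\<close>, and \<open>P\<close> extends the conditioned
measures. A path that hits all large levels without \<open>X\<^sub>\<infinity> = \<infinity>\<close> must hit all small levels as well,
and \<open>Q(T\<^sub>c < \<TT>) = c\<close> is small if \<open>c\<close> is; so \<open>X\<^sub>\<infinity> = \<infinity>\<close> holds \<open>Q\<close>-almost surely. Now both sides of the first
claim have the density \<open>a\<close> on \<open>{T\<^sub>c < \<TT>}\<close> and \<open>1/\<infinity> = 0\<close> elsewhere (\<open>conditioning_density\<close>).

For uniqueness, let \<open>R\<close> agree with \<open>P\<close> up to the hitting times of all levels \<open>1/a\<close>. Say that a path
from \<open>1\<close> survives as long as it has not come arbitrarily close to \<open>0\<close>, that is, as long as some of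
these hitting times is still to come. Then \<open>R\<close> and \<open>P\<close> agree on all events about surviving values.
After survival the path is at \<open>0\<close> under \<open>P\<close>, while under \<open>R\<close> it might conceivably have jumped to \<open>\<infinity>\<close>.
However, that the path tends to \<open>0\<close> at the end of survival is an event about surviving values
only, so it has full measure under \<open>R\<close> too; and paths in \<^term>\<open>C_abs\<close> with left limit \<open>0\<close> do not jump. So
\<open>R = P\<close> (\<open>measure_determined_before_vanishing\<close>).
\<close>

section \<open>Paths and their hitting times\<close>

lemma xtime_le_simps [simp]:
  "Time u \<le> Time v \<longleftrightarrow> u \<le> v" "x \<le> Beyond" "\<not> Beyond \<le> Time v"
  "Time u < Time v \<longleftrightarrow> u < v" "Time u < Beyond" "\<not> Beyond < x"
  by (auto simp: less_eq_xtime_def less_xtime_def split: xtime.splits)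

lemma less_Beyond_iff: "x < Beyond \<longleftrightarrow> x \<noteq> Beyond"
  by (cases x) auto

lemma X_ennreal: "0 \<le> s \<Longrightarrow> X (ennreal s) \<omega> = \<omega> s"
  by (simp add: X_def)

lemma C_abs_zero_absorbing: "\<omega> \<in> C_abs \<Longrightarrow> 0 \<le> s \<Longrightarrow> s \<le> t \<Longrightarrow> \<omega> s = 0 \<Longrightarrow> \<omega> t = 0"
  unfolding C_abs_def by blast

lemma C_abs_inf_absorbing: "\<omega> \<in> C_abs \<Longrightarrow> 0 \<le> s \<Longrightarrow> s \<le> t \<Longrightarrow> \<omega> s = \<infinity> \<Longrightarrow> \<omega> t = \<infinity>"
  unfolding C_abs_def by blast

lemma X_eq_in_finite_time:
  assumes "X u \<omega> = c" "u \<noteq> \<infinity>"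
  obtains s where "0 \<le> s" "u = ennreal s" "\<omega> s = c"
  using assms by (cases u) (auto simp: X_ennreal)

lemma hitting_time_le_finite_time:
  assumes "hitting_time c \<omega> = Time v"
  shows "X u \<omega> = c \<Longrightarrow> v \<le> u" and "v < u \<Longrightarrow> \<exists>t<u. X t \<omega> = c"
  using assms by (auto simp: hitting_time_def Inf_less_iff intro!: Inf_lower split: if_splits)

text \<open>
The clause of \<^term>\<open>C_abs\<close> that makes \<open>T\<^sub>\<infinity>\<close> a genuine first hitting time is what gives the direction from
left to right. It turns the domain of continuity into \<open>{t. \<omega> t \<noteq> \<infinity>}\<close>, in which form continuity is
used from here on.
\<close>

lemma hitting_time_inf_le_iff:
  assumes C: "\<omega> \<in> C_abs" and s: "0 \<le> s"
  shows "hitting_time \<infinity> \<omega> \<le> Time (ennreal s) \<longleftrightarrow> \<omega> s = \<infinity>"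
proof
  assume le: "hitting_time \<infinity> \<omega> \<le> Time (ennreal s)"
  then obtain v where v: "hitting_time \<infinity> \<omega> = Time v" "v \<le> ennreal s"
    by (cases "hitting_time \<infinity> \<omega>") auto
  then obtain t where t: "0 \<le> t" "v = ennreal t"
    by (cases v) (auto simp: top_unique)
  then have "\<omega> t = \<infinity>"
    using C v unfolding C_abs_def by auto
  then show "\<omega> s = \<infinity>"
    using C_abs_inf_absorbing[OF C, of t s] t v(2) s by simp
next
  assume "\<omega> s = \<infinity>"
  then have "X (ennreal s) \<omega> = \<infinity>" using s by (simp add: X_ennreal)
  then show "hitting_time \<infinity> \<omega> \<le> Time (ennreal s)"
    by (auto simp: hitting_time_def intro!: Inf_lower)
qed

lemma C_abs_continuous_on:
  assumes C: "\<omega> \<in> C_abs"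
  shows "continuous_on {t. 0 \<le> t \<and> \<omega> t \<noteq> \<infinity>} \<omega>"
proof -
  have "{t. 0 \<le> t \<and> \<omega> t \<noteq> \<infinity>} = {t. 0 \<le> t \<and> Time (ennreal t) < hitting_time \<infinity> \<omega>}"
    using hitting_time_inf_le_iff[OF C] by (auto simp: not_le[symmetric])
  then show ?thesis
    using C unfolding C_abs_def by simp
qed

lemma C_abs_continuous_on_Icc:
  assumes C: "\<omega> \<in> C_abs" and r: "\<omega> r \<noteq> \<infinity>"
  shows "continuous_on {0..r} \<omega>"
  using C_abs_inf_absorbing[OF C, of _ r] r
  by (intro continuous_on_subset[OF C_abs_continuous_on[OF C]]) auto

lemma C_abs_first_inf:
  assumes C: "\<omega> \<in> C_abs" and s: "0 \<le> s" "\<omega> s = \<infinity>"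
  obtains t where "0 \<le> t" "t \<le> s" "\<omega> t = \<infinity>" "\<And>r. 0 \<le> r \<Longrightarrow> r < t \<Longrightarrow> \<omega> r \<noteq> \<infinity>"
    "0 < t \<Longrightarrow> \<not> (\<omega> \<longlongrightarrow> 0) (at_left t)"
proof -
  have "hitting_time \<infinity> \<omega> \<le> Time (ennreal s)"
    using hitting_time_inf_le_iff[OF C s(1)] s(2) by simp
  then obtain v where v: "hitting_time \<infinity> \<omega> = Time v" "v \<le> ennreal s"
    by (cases "hitting_time \<infinity> \<omega>") auto
  then obtain t where t: "0 \<le> t" "v = ennreal t"
    by (cases v) (auto simp: top_unique)
  have "\<omega> t = \<infinity> \<and> (0 < t \<longrightarrow> \<not> (\<omega> \<longlongrightarrow> 0) (at_left t))"
    using C v t unfolding C_abs_def by auto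
  moreover have "\<omega> r \<noteq> \<infinity>" if "0 \<le> r" "r < t" for r
    using hitting_time_inf_le_iff[OF C that(1)] v t that by simp
  ultimately show ?thesis
    using that[of t] t v s by (auto simp: ennreal_le_iff)
qed

text \<open>
The set of times with a finite value is \<open>[0, T\<^sub>\<infinity>)\<close>, and it is open on the right because the value
at \<open>T\<^sub>\<infinity>\<close> is infinite. With absorption in \<open>\<infinity>\<close> this makes every path right-continuous everywhere, jumps
to \<open>\<infinity>\<close> included.
\<close>

lemma C_abs_finite_right:
  assumes C: "\<omega> \<in> C_abs" and r: "0 \<le> r" "\<omega> r \<noteq> \<infinity>"
  obtains d where "r < d" "\<omega> d \<noteq> \<infinity>"
proof (cases "\<omega> (r + 1) = \<infinity>")
  case True
  then obtain t where t: "0 \<le> t" "\<omega> t = \<infinity>" "\<And>r. 0 \<le> r \<Longrightarrow> r < t \<Longrightarrow> \<omega> r \<noteq> \<infinity>"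
    using C_abs_first_inf[OF C, of "r + 1"] r by (metis add_increasing2 zero_le_one)
  have "r < t"
    using C_abs_inf_absorbing[OF C t(1) _ t(2), of r] r by fastforce
  then show ?thesis
    using that[of "(r + t) / 2"] t(3)[of "(r + t) / 2"] r by auto
qed (use that[of "r + 1"] in auto)

lemma C_abs_right_continuous:
  assumes C: "\<omega> \<in> C_abs" and r: "0 \<le> r"
  shows "(\<omega> \<longlongrightarrow> \<omega> r) (at_right r)"
proof (cases "\<omega> r = \<infinity>")
  case True
  have "\<forall>\<^sub>F t in at_right r. \<omega> t = \<infinity>"
    using C_abs_inf_absorbing[OF C r _ True] by (auto simp: eventually_at_right_field intro!: exI[of _ "r + 1"])
  then show ?thesis
    using True by (simp add: tendsto_eventually)
next
  case False
  then obtain d where d: "r < d" "\<omega> d \<noteq> \<infinity>"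
    using C_abs_finite_right[OF C r] by blast
  have "continuous_on {r..d} \<omega>"
    using C_abs_continuous_on_Icc[OF C d(2)] by (rule continuous_on_subset) (use r in auto)
  then show ?thesis
    using d(1) by (rule continuous_on_Icc_at_rightD)
qed

lemma C_abs_stays_in_open:
  assumes C: "\<omega> \<in> C_abs" and u: "0 \<le> u" and U: "open U" "\<omega> u \<in> U"
  obtains d where "u < d" "\<And>v. u \<le> v \<Longrightarrow> v < d \<Longrightarrow> \<omega> v \<in> U"
proof -
  have "\<forall>\<^sub>F v in at_right u. \<omega> v \<in> U"
    using C_abs_right_continuous[OF C u] U by (rule topological_tendstoD)
  then obtain d where "u < d" "\<And>v. u < v \<Longrightarrow> v < d \<Longrightarrow> \<omega> v \<in> U"
    by (auto simp: eventually_at_right_field)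
  then show ?thesis
    using that[of d] U(2) by (metis less_eq_real_def)
qed

text \<open>
The end point is added because it may be irrational, and a path may take a value at \<open>r\<close> only.
\<close>

definition rational_times :: "real \<Rightarrow> real set" where
  "rational_times r = insert r (\<rat> \<inter> {0..r})"

lemma countable_rational_times [simp]: "countable (rational_times r)"
  unfolding rational_times_def using countable_rat by (auto intro: countable_subset)

lemma rational_times_bounds: "0 \<le> r \<Longrightarrow> q \<in> rational_times r \<Longrightarrow> 0 \<le> q \<and> q \<le> r"
  by (auto simp: rational_times_def)

text \<open>
Whatever a path does at some time up to \<open>r\<close> it still does, up to an open condition, at one of
countably many times up to \<open>r\<close>, and all the way until then. This is how events about uncountably
many times become measurable.
\<close>

lemma C_abs_rational_time_nearby:
  assumes C: "\<omega> \<in> C_abs" and u: "0 \<le> u" "u \<le> r" and U: "open U" "\<omega> u \<in> U"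
  obtains q where "q \<in> rational_times r" "u \<le> q" "\<And>v. u \<le> v \<Longrightarrow> v \<le> q \<Longrightarrow> \<omega> v \<in> U"
proof (cases "u = r")
  case True
  then show ?thesis
    using that[of r] U(2) by (auto simp: rational_times_def)
next
  case False
  obtain d where d: "u < d" "\<And>v. u \<le> v \<Longrightarrow> v < d \<Longrightarrow> \<omega> v \<in> U"
    using C_abs_stays_in_open[OF C u(1) U] by blast
  obtain q where "q \<in> \<rat>" "u < q" "q < min d r"
    using Rats_dense_in_real[of u "min d r"] d(1) u(2) False by auto
  then show ?thesis
    using that[of q] d(2) u by (auto simp: rational_times_def)
qed

lemma C_abs_IVT:
  assumes C: "\<omega> \<in> C_abs" and fin: "\<omega> r \<noteq> \<infinity>" and uv: "0 \<le> u" "u \<le> v" "v \<le> r"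
    and c: "\<omega> u \<le> c \<and> c \<le> \<omega> v \<or> \<omega> v \<le> c \<and> c \<le> \<omega> u"
  obtains w where "u \<le> w" "w \<le> v" "\<omega> w = c"
proof -
  have "continuous_on {u..v} \<omega>"
    using C_abs_continuous_on_Icc[OF C fin] by (rule continuous_on_subset) (use uv in auto)
  then show ?thesis
    using IVT'[of \<omega> u c v] IVT2'[of \<omega> v c u] c uv(2) that by blast
qed

text \<open>
By right-continuity a level that is not attained at \<open>s\<close> is avoided on some \<open>[s, d)\<close>, so that \<open>s\<close> is
not the infimum of the hitting times.
\<close>

lemma C_abs_first_hit:
  assumes C: "\<omega> \<in> C_abs" and s: "0 \<le> s" and hit: "hitting_time c \<omega> = Time (ennreal s)"
  shows "\<omega> s = c"
proof (rule ccontr)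
  assume "\<omega> s \<noteq> c"
  then obtain d where d: "s < d" "\<And>v. s \<le> v \<Longrightarrow> v < d \<Longrightarrow> \<omega> v \<in> - {c}"
    using C_abs_stays_in_open[OF C s, of "- {c}"] by auto
  have "ennreal s < ennreal d"
    using d(1) s by (simp add: ennreal_less_iff)
  then obtain t where t: "t < ennreal d" "X t \<omega> = c" "ennreal s \<le> t"
    using hitting_time_le_finite_time[OF hit] by meson
  moreover obtain v where "0 \<le> v" "t = ennreal v" "\<omega> v = c"
    using X_eq_in_finite_time[OF t(2)] t(1) by (metis infinity_ennreal_def not_less_iff_gr_or_eq top.not_eq_extremum top_greatest leD)
  ultimately show False
    using d(2)[of v] s d(1) by (auto simp: ennreal_less_iff)
qed

lemma hitting_time_le_iff:
  assumes C: "\<omega> \<in> C_abs" and s: "0 \<le> s"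
  shows "hitting_time c \<omega> \<le> Time (ennreal s) \<longleftrightarrow> (\<exists>u. 0 \<le> u \<and> u \<le> s \<and> \<omega> u = c)"
proof
  assume "hitting_time c \<omega> \<le> Time (ennreal s)"
  then obtain v where v: "hitting_time c \<omega> = Time v" "v \<le> ennreal s"
    by (cases "hitting_time c \<omega>") auto
  then obtain t where t: "0 \<le> t" "v = ennreal t"
    by (cases v) (auto simp: top_unique)
  then show "\<exists>u. 0 \<le> u \<and> u \<le> s \<and> \<omega> u = c"
    using C_abs_first_hit[OF C t(1)] v s by auto
next
  assume "\<exists>u. 0 \<le> u \<and> u \<le> s \<and> \<omega> u = c"
  then obtain u where u: "0 \<le> u" "u \<le> s" "\<omega> u = c" by blast
  then have "X (ennreal u) \<omega> = c" by (simp add: X_ennreal)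
  then have "hitting_time c \<omega> \<le> Time (ennreal u)"
    by (auto simp: hitting_time_def intro!: Inf_lower)
  also have "\<dots> \<le> Time (ennreal s)" using u by (simp add: ennreal_leI)
  finally show "hitting_time c \<omega> \<le> Time (ennreal s)" .
qed

text \<open>
The level may be reached only by the value \<open>X\<^sub>\<infinity>\<close>: then the hitting time is \<open>Time \<infinity>\<close>.
\<close>

lemma hitting_time_less_Beyond_iff:
  "hitting_time c \<omega> < Beyond \<longleftrightarrow> (\<exists>s\<ge>0. \<omega> s = c) \<or> path_at_inf \<omega> = c"
proof -
  have "(\<exists>t. X t \<omega> = c) \<longleftrightarrow> (\<exists>s\<ge>0. \<omega> s = c) \<or> path_at_inf \<omega> = c"
    by (metis X_def X_ennreal X_eq_in_finite_time)
  then show ?thesis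
    by (simp add: hitting_time_def less_Beyond_iff)
qed

lemma ennreal_sqrt_square: "ennreal_sqrt (x * x) = x"
  by (cases x) (auto simp: ennreal_sqrt_def ennreal_mult[symmetric] enn2real_ennreal
      ennreal_top_mult ennreal_mult_eq_top_iff)

lemma path_at_inf_tendsto:
  assumes "(\<omega> \<longlongrightarrow> c) at_top"
  shows "path_at_inf \<omega> = c"
proof -
  have "Limsup at_top \<omega> = c" "Liminf at_top \<omega> = c"
    using assms by (auto intro!: lim_imp_Limsup lim_imp_Liminf)
  then show ?thesis
    by (auto simp: path_at_inf_def Let_def ennreal_sqrt_square)
qed

text \<open>
The stopped path is constant from \<open>s\<close> on, so that its value at infinity is \<open>\<omega> s\<close>. If no stopping
takes place before \<open>\<infinity>\<close>, the value is that of the path itself.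
\<close>

lemma X_at_finite:
  assumes "\<tau> \<omega> = Time (ennreal s)" "0 \<le> s"
  shows "X_at \<tau> \<omega> = \<omega> s"
proof -
  have "\<forall>\<^sub>F t in at_top. stop_path (\<tau> \<omega>) \<omega> t = \<omega> s"
    unfolding eventually_at_top_linorder using assms
    by (intro exI[of _ s]) (auto simp: min_absorb2 X_ennreal ennreal_leI)
  then show ?thesis
    unfolding X_at_def by (simp add: X_def path_at_inf_tendsto tendsto_eventually)
qed

lemma X_at_infinite:
  assumes "\<tau> \<omega> = Time \<infinity> \<or> \<tau> \<omega> = Beyond"
  shows "X_at \<tau> \<omega> = path_at_inf \<omega>"
proof -
  have *: "\<forall>\<^sub>F t in at_top. stop_path (\<tau> \<omega>) \<omega> t = \<omega> t"
    unfolding eventually_at_top_linorder using assms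
    by (intro exI[of _ 0]) (auto simp: min_def X_ennreal top_unique)
  have "Limsup at_top (stop_path (\<tau> \<omega>) \<omega>) = Limsup at_top \<omega>"
    "Liminf at_top (stop_path (\<tau> \<omega>) \<omega>) = Liminf at_top \<omega>"
    using Limsup_eq[OF *] Liminf_eq[OF *] by auto
  then show ?thesis
    by (simp add: X_at_def X_def path_at_inf_def)
qed

lemma X_at_hitting_time:
  assumes C: "\<omega> \<in> C_abs" and hit: "hitting_time c \<omega> < Beyond"
  shows "X_at (hitting_time c) \<omega> = c"
proof -
  obtain v where v: "hitting_time c \<omega> = Time v"
    using hit by (cases "hitting_time c \<omega>") auto
  show ?thesis
  proof (cases "v = \<infinity>")
    case False
    then obtain s where s: "0 \<le> s" "v = ennreal s" by (cases v) auto
    then show ?thesis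
      using X_at_finite[of "hitting_time c" \<omega> s] C_abs_first_hit[OF C s(1)] v by simp
  next
    case True
    have "\<not> (\<exists>s\<ge>0. \<omega> s = c)"
    proof
      assume "\<exists>s\<ge>0. \<omega> s = c"
      then obtain s where "0 \<le> s" "X (ennreal s) \<omega> = c" by (auto simp: X_ennreal)
      then show False using hitting_time_le_finite_time(1)[OF v, of "ennreal s"] True by (simp add: top_unique)
    qed
    then show ?thesis
      using hit hitting_time_less_Beyond_iff[of c \<omega>] X_at_infinite[of "hitting_time c" \<omega>] v True by auto
  qed
qed

section \<open>Measurability\<close>

lemma space_Filt [simp]: "space (Filt t) = C_abs"
  by (simp add: Filt_def space_measure_of_conv)

lemma Filt_gen_sub: "{X (ennreal s) -` B \<inter> C_abs | s B. 0 \<le> s \<and> s \<le> t \<and> B \<in> sets borel} \<subseteq> Pow C_abs"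
  by auto

lemma sets_Filt_mono: "s \<le> t \<Longrightarrow> sets (Filt s) \<subseteq> sets (Filt t)"
  unfolding Filt_def sets_measure_of[OF Filt_gen_sub]
  by (intro sigma_sets_mono') fastforce

lemma space_Filt_inf [simp]: "space Filt_inf = C_abs"
  by (simp add: Filt_inf_def space_measure_of_conv)

lemma sets_Filt_subset: "0 \<le> t \<Longrightarrow> sets (Filt t) \<subseteq> sets Filt_inf"
  using sets.space_closed[of "Filt _"] unfolding Filt_inf_def
  by (subst sets_measure_of) (auto simp: space_Filt)

lemma eval_measurable_Filt:
  assumes "0 \<le> s" "s \<le> t"
  shows "(\<lambda>\<omega>. \<omega> s) \<in> borel_measurable (Filt t)"
proof (rule measurableI)
  fix B :: "ennreal set" assume "B \<in> sets borel"
  moreover have "(\<lambda>\<omega>. \<omega> s) -` B \<inter> C_abs = X (ennreal s) -` B \<inter> C_abs"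
    using assms by (auto simp: X_ennreal)
  ultimately show "(\<lambda>\<omega>. \<omega> s) -` B \<inter> space (Filt t) \<in> sets (Filt t)"
    unfolding space_Filt unfolding Filt_def sets_measure_of[OF Filt_gen_sub]
    using assms by (intro sigma_sets.Basic) auto
qed simp

lemma eval_measurable_Filt_inf: "0 \<le> s \<Longrightarrow> (\<lambda>\<omega>. \<omega> s) \<in> borel_measurable Filt_inf"
  using eval_measurable_Filt[of s s] sets_Filt_subset[of s]
  by (auto simp: measurable_def)

lemma level_sets_measurable:
  assumes "f \<in> borel_measurable M" and "B \<in> sets borel"
  shows "{\<omega> \<in> space M. f \<omega> \<in> B} \<in> sets M"
  using measurable_sets[OF assms] by (simp add: vimage_def Int_def conj_commute)

text \<open>
The generating family of \<^term>\<open>Filt_at \<tau>\<close> is itself a sigma-algebra; complements within \<open>{\<tau> \<le> t}\<close> use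
that \<open>\<tau>\<close> is a stopping time.
\<close>

lemma sets_Filt_at_iff:
  assumes \<tau>: "is_stopping_time \<tau>"
  shows "A \<in> sets (Filt_at \<tau>) \<longleftrightarrow>
    A \<in> sets Filt_inf \<and> (\<forall>t\<ge>0. A \<inter> {\<omega> \<in> C_abs. \<tau> \<omega> \<le> Time (ennreal t)} \<in> sets (Filt t))"
proof -
  let ?S = "\<lambda>t. {\<omega> \<in> C_abs. \<tau> \<omega> \<le> Time (ennreal t)}"
  have S: "?S t \<in> sets (Filt t)" if "0 \<le> t" for t
    using \<tau> that by (simp add: is_stopping_time_def)
  let ?G = "{A \<in> sets Filt_inf. \<forall>t\<ge>0. A \<inter> ?S t \<in> sets (Filt t)}"
  have "sigma_algebra C_abs ?G"
    unfolding sigma_algebra_iff2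
  proof (intro conjI ballI allI impI)
    show "?G \<subseteq> Pow C_abs" using sets.space_closed[of Filt_inf] by auto
    show "{} \<in> ?G" by simp
  next
    fix B assume B: "B \<in> ?G"
    have "(C_abs - B) \<inter> ?S t = ?S t - B \<inter> ?S t" for t by auto
    then show "C_abs - B \<in> ?G"
      using B S sets.compl_sets[of B Filt_inf] by auto
  next
    fix B :: "nat \<Rightarrow> path set" assume B: "range B \<subseteq> ?G"
    have "(\<Union>i. B i) \<inter> ?S t = (\<Union>i. B i \<inter> ?S t)" for t by auto
    moreover have "(\<Union>i. B i) \<in> sets Filt_inf" using B by auto
    moreover have "(\<Union>i. B i \<inter> ?S t) \<in> sets (Filt t)" if "0 \<le> t" for t
      using B that by (intro sets.countable_UN) auto
    ultimately show "(\<Union>i. B i) \<in> ?G" by simp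
  qed
  then show ?thesis
    unfolding Filt_at_def by (subst sigma_algebra.sets_measure_of_eq) auto
qed

lemma space_Filt_at [simp]: "space (Filt_at \<tau>) = C_abs"
  by (simp add: Filt_at_def space_measure_of_conv)

lemma Filt_0_in_Filt_at:
  assumes \<tau>: "is_stopping_time \<tau>" and A: "A \<in> sets (Filt 0)"
  shows "A \<in> sets (Filt_at \<tau>)"
  unfolding sets_Filt_at_iff[OF \<tau>]
  using A \<tau> sets_Filt_subset[of 0] sets_Filt_mono[of 0] unfolding is_stopping_time_def by fastforce

lemma stopping_time_min:
  assumes "is_stopping_time \<sigma>" "is_stopping_time \<tau>"
  shows "is_stopping_time (\<lambda>\<omega>. min (\<sigma> \<omega>) (\<tau> \<omega>))"
proof -
  have "{\<omega> \<in> C_abs. min (\<sigma> \<omega>) (\<tau> \<omega>) \<le> Time t} =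
      {\<omega> \<in> C_abs. \<sigma> \<omega> \<le> Time t} \<union> {\<omega> \<in> C_abs. \<tau> \<omega> \<le> Time t}" for t
    by (auto simp: min_le_iff_disj)
  then show ?thesis using assms by (auto simp: is_stopping_time_def)
qed

text \<open>
Before a jump to \<open>\<infinity>\<close> a path may approach the level \<open>c\<close> without attaining it, so it is not enough
that the path comes arbitrarily close to \<open>c\<close> on \<open>[0,t]\<close>. If the path is finite at \<open>r\<close>, however, it is
continuous on the compact interval \<open>[0,r]\<close>, and there it attains \<open>c\<close> if and only if \<open>c\<close> lies between
its infimum and its supremum. These can be taken over countably many times, and countably many
\<open>r \<le> t\<close> suffice.
\<close>

lemma stopping_time_hitting_time:
  assumes c: "c \<noteq> \<infinity>"
  shows "is_stopping_time (hitting_time c)"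
  unfolding is_stopping_time_def
proof (intro allI impI)
  fix t :: real assume t: "0 \<le> t"
  let ?E = "\<lambda>r. {\<omega> \<in> space (Filt t). \<omega> r < \<infinity> \<and>
      (INF q\<in>rational_times r. \<omega> q) \<le> c \<and> c \<le> (SUP q\<in>rational_times r. \<omega> q)}"
  have hit: "(\<exists>u. 0 \<le> u \<and> u \<le> t \<and> \<omega> u = c) \<longleftrightarrow> (\<exists>r\<in>rational_times t. \<omega> \<in> ?E r)"
    if C: "\<omega> \<in> C_abs" for \<omega>
  proof
    assume "\<exists>u. 0 \<le> u \<and> u \<le> t \<and> \<omega> u = c"
    then obtain u where u: "0 \<le> u" "u \<le> t" "\<omega> u = c" by blast
    obtain r where r: "r \<in> rational_times t" "u \<le> r" "\<omega> r < \<infinity>"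
      using C_abs_rational_time_nearby[OF C u(1,2), of "{..<\<infinity>}"] u(3) c
      by (auto simp: less_top[symmetric])
    have "(INF q\<in>rational_times r. \<omega> q) \<le> c"
    proof (rule dense_ge)
      fix y assume "c < y"
      then obtain q where "q \<in> rational_times r" "\<omega> q < y"
        using C_abs_rational_time_nearby[OF C u(1) r(2), of "{..<y}"] u(3) by auto
      then show "(INF q\<in>rational_times r. \<omega> q) \<le> y"
        by (auto intro: INF_lower2)
    qed
    moreover have "c \<le> (SUP q\<in>rational_times r. \<omega> q)"
    proof (rule dense_le)
      fix y assume "y < c"
      then obtain q where "q \<in> rational_times r" "y < \<omega> q"
        using C_abs_rational_time_nearby[OF C u(1) r(2), of "{y<..}"] u(3) by auto
      then show "y \<le> (SUP q\<in>rational_times r. \<omega> q)"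
        by (auto intro: SUP_upper2)
    qed
    ultimately show "\<exists>r\<in>rational_times t. \<omega> \<in> ?E r" using r C by auto
  next
    assume "\<exists>r\<in>rational_times t. \<omega> \<in> ?E r"
    then obtain r where r: "r \<in> rational_times t" and E: "\<omega> \<in> ?E r" by blast
    note rt = rational_times_bounds[OF t r]
    have fin: "\<omega> r \<noteq> \<infinity>" using E by auto
    note cont = C_abs_continuous_on_Icc[OF C fin]
    obtain v where v: "v \<in> {0..r}" "\<And>q. q \<in> {0..r} \<Longrightarrow> \<omega> v \<le> \<omega> q"
      using continuous_attains_inf[OF compact_Icc _ cont] rt by auto
    obtain w where w: "w \<in> {0..r}" "\<And>q. q \<in> {0..r} \<Longrightarrow> \<omega> q \<le> \<omega> w"
      using continuous_attains_sup[OF compact_Icc _ cont] rt by auto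
    have "\<omega> v \<le> (INF q\<in>rational_times r. \<omega> q)"
      by (intro INF_greatest v(2)) (use rational_times_bounds[OF conjunct1[OF rt]] in auto)
    moreover have "(SUP q\<in>rational_times r. \<omega> q) \<le> \<omega> w"
      by (intro SUP_least w(2)) (use rational_times_bounds[OF conjunct1[OF rt]] in auto)
    ultimately have vw: "\<omega> v \<le> c" "c \<le> \<omega> w" using E by (auto intro: order_trans)
    consider "v \<le> w" | "w \<le> v" by linarith
    then show "\<exists>u. 0 \<le> u \<and> u \<le> t \<and> \<omega> u = c"
    proof cases
      case 1
      then obtain u where "v \<le> u" "u \<le> w" "\<omega> u = c"
        using C_abs_IVT[OF C fin, of v w c] v(1) w(1) vw by auto
      then show ?thesis using v w rt by (intro exI[of _ u]) auto
    next
      case 2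
      then obtain u where "w \<le> u" "u \<le> v" "\<omega> u = c"
        using C_abs_IVT[OF C fin, of w v c] v(1) w(1) vw by auto
      then show ?thesis using v w rt by (intro exI[of _ u]) auto
    qed
  qed
  have "?E r \<in> sets (Filt t)" if r: "r \<in> rational_times t" for r
  proof -
    have [measurable]: "(\<lambda>\<omega>. \<omega> q) \<in> borel_measurable (Filt t)" if "q \<in> insert r (rational_times r)" for q
      using that rational_times_bounds[OF t r] rational_times_bounds[of r q]
      by (intro eval_measurable_Filt) auto
    have [measurable]: "(\<lambda>\<omega>. \<omega> r) \<in> borel_measurable (Filt t)"
      "(\<lambda>\<omega>. INF q\<in>rational_times r. \<omega> q) \<in> borel_measurable (Filt t)"
      "(\<lambda>\<omega>. SUP q\<in>rational_times r. \<omega> q) \<in> borel_measurable (Filt t)"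
      by (auto intro!: borel_measurable_INF borel_measurable_SUP)
    show ?thesis by measurable
  qed
  then have "(\<Union>r\<in>rational_times t. ?E r) \<in> sets (Filt t)"
    by (intro sets.countable_UN') auto
  moreover have "(\<Union>r\<in>rational_times t. ?E r) = {\<omega> \<in> C_abs. hitting_time c \<omega> \<le> Time (ennreal t)}"
    using hit hitting_time_le_iff[OF _ t] by auto
  ultimately show "{\<omega> \<in> C_abs. hitting_time c \<omega> \<le> Time (ennreal t)} \<in> sets (Filt t)"
    by simp
qed

text \<open>
Right-continuity allows the limits at infinity to be taken along rational times, which makes \<open>X\<^sub>\<infinity>\<close>
measurable.
\<close>

lemma Limsup_path:
  assumes C: "\<omega> \<in> C_abs"
  shows "Limsup at_top \<omega> = (INF n::nat. SUP q\<in>\<rat> \<inter> {real n..}. \<omega> q)"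
proof (rule antisym)
  show "Limsup at_top \<omega> \<le> (INF n::nat. SUP q\<in>\<rat> \<inter> {real n..}. \<omega> q)"
  proof (intro INF_greatest Limsup_bounded)
    fix n :: nat
    have "\<omega> t \<le> (SUP q\<in>\<rat> \<inter> {real n..}. \<omega> q)" if t: "real n \<le> t" for t
    proof (rule dense_le)
      fix y assume "y < \<omega> t"
      then obtain d where d: "t < d" "\<And>v. t \<le> v \<Longrightarrow> v < d \<Longrightarrow> y < \<omega> v"
        using C_abs_stays_in_open[OF C, of t "{y<..}"] t by auto
      obtain q where "q \<in> \<rat>" "t < q" "q < d" using Rats_dense_in_real[OF d(1)] by blast
      then show "y \<le> (SUP q\<in>\<rat> \<inter> {real n..}. \<omega> q)"
        using d(2)[of q] t by (intro SUP_upper2[of q]) auto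
    qed
    then show "\<forall>\<^sub>F t in at_top. \<omega> t \<le> (SUP q\<in>\<rat> \<inter> {real n..}. \<omega> q)"
      unfolding eventually_at_top_linorder by blast
  qed
  show "(INF n::nat. SUP q\<in>\<rat> \<inter> {real n..}. \<omega> q) \<le> Limsup at_top \<omega>"
    unfolding Limsup_def
  proof (rule INF_greatest)
    fix P :: "real \<Rightarrow> bool" assume "P \<in> {P. eventually P at_top}"
    then obtain c where c: "\<And>t. c \<le> t \<Longrightarrow> P t" by (auto simp: eventually_at_top_linorder)
    show "(INF n::nat. SUP q\<in>\<rat> \<inter> {real n..}. \<omega> q) \<le> \<Squnion> (\<omega> ` Collect P)"
      using c real_nat_ceiling_ge[of c]
      by (intro INF_lower2[of "nat \<lceil>c\<rceil>"] SUP_subset_mono) auto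
  qed
qed

lemma Liminf_path:
  assumes C: "\<omega> \<in> C_abs"
  shows "Liminf at_top \<omega> = (SUP n::nat. INF q\<in>\<rat> \<inter> {real n..}. \<omega> q)"
proof (rule antisym)
  show "(SUP n::nat. INF q\<in>\<rat> \<inter> {real n..}. \<omega> q) \<le> Liminf at_top \<omega>"
  proof (intro SUP_least Liminf_bounded)
    fix n :: nat
    have "(INF q\<in>\<rat> \<inter> {real n..}. \<omega> q) \<le> \<omega> t" if t: "real n \<le> t" for t
    proof (rule dense_ge)
      fix y assume "\<omega> t < y"
      then obtain d where d: "t < d" "\<And>v. t \<le> v \<Longrightarrow> v < d \<Longrightarrow> \<omega> v < y"
        using C_abs_stays_in_open[OF C, of t "{..<y}"] t by auto
      obtain q where "q \<in> \<rat>" "t < q" "q < d" using Rats_dense_in_real[OF d(1)] by blast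
      then show "(INF q\<in>\<rat> \<inter> {real n..}. \<omega> q) \<le> y"
        using d(2)[of q] t by (intro INF_lower2[of q]) auto
    qed
    then show "\<forall>\<^sub>F t in at_top. (INF q\<in>\<rat> \<inter> {real n..}. \<omega> q) \<le> \<omega> t"
      unfolding eventually_at_top_linorder by blast
  qed
  show "Liminf at_top \<omega> \<le> (SUP n::nat. INF q\<in>\<rat> \<inter> {real n..}. \<omega> q)"
    unfolding Liminf_def
  proof (rule SUP_least)
    fix P :: "real \<Rightarrow> bool" assume "P \<in> {P. eventually P at_top}"
    then obtain c where c: "\<And>t. c \<le> t \<Longrightarrow> P t" by (auto simp: eventually_at_top_linorder)
    show "\<Sqinter> (\<omega> ` Collect P) \<le> (SUP n::nat. INF q\<in>\<rat> \<inter> {real n..}. \<omega> q)"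
      using c real_nat_ceiling_ge[of c]
      by (intro SUP_upper2[of "nat \<lceil>c\<rceil>"] INF_superset_mono) auto
  qed
qed

lemma path_at_inf_measurable: "path_at_inf \<in> borel_measurable Filt_inf"
proof -
  let ?S = "\<lambda>\<omega>. INF n::nat. SUP q\<in>\<rat> \<inter> {real n..}. \<omega> q :: ennreal"
  let ?I = "\<lambda>\<omega>. SUP n::nat. INF q\<in>\<rat> \<inter> {real n..}. \<omega> q :: ennreal"
  have cnt: "countable (\<rat> \<inter> {real n..})" for n
    using countable_rat by (auto intro: countable_subset)
  have S[measurable]: "?S \<in> borel_measurable Filt_inf"
    by (intro borel_measurable_INF borel_measurable_SUP cnt eval_measurable_Filt_inf) auto
  have I[measurable]: "?I \<in> borel_measurable Filt_inf"
    by (intro borel_measurable_INF borel_measurable_SUP cnt eval_measurable_Filt_inf) auto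
  have sqrt[measurable]: "ennreal_sqrt \<in> borel_measurable borel"
    unfolding ennreal_sqrt_def[abs_def] by measurable
  have "(\<lambda>\<omega>. ennreal_sqrt (if ?S \<omega> = \<infinity> \<and> ?I \<omega> = 0 then 1 else ?S \<omega> * ?I \<omega>)) \<in> borel_measurable Filt_inf"
    by measurable
  then show ?thesis
    by (rule measurable_cong[THEN iffD1, rotated])
      (simp only: path_at_inf_def Limsup_path Liminf_path Let_def space_Filt_inf)
qed

section \<open>Stopped paths on finite grids of times\<close>

text \<open>
The minimum of \<open>t\<close> and an extended time, as a real number: \<open>stopped \<tau> t \<omega>\<close> is the value of \<open>\<omega>\<close> at
\<open>cap t (\<tau> \<omega>)\<close>.
\<close>

fun cap :: "real \<Rightarrow> xtime \<Rightarrow> real" where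
  "cap t (Time u) = enn2real (min (ennreal t) u)"
| "cap t Beyond = t"

lemma cap_Time_ennreal: "0 \<le> t \<Longrightarrow> 0 \<le> u \<Longrightarrow> cap t (Time (ennreal u)) = min t u"
  by (simp add: min_def ennreal_le_iff)

lemma cap_cases:
  assumes "0 \<le> t"
  obtains "cap t x = t" "Time (ennreal t) \<le> x"
    | u where "0 \<le> u" "u < t" "x = Time (ennreal u)" "cap t x = u"
proof (cases x)
  case Beyond
  then show ?thesis using that(1) by simp
next
  case (Time v)
  show ?thesis
  proof (cases "ennreal t \<le> v")
    case True
    then show ?thesis using that(1) Time assms by (simp add: min_absorb1)
  next
    case False
    then obtain u where u: "0 \<le> u" "v = ennreal u" by (cases v) auto
    then have "u < t" using False assms by (simp add: ennreal_le_iff not_le ennreal_less_iff)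
    then show ?thesis
      using that(2)[of u] Time u assms by (simp add: cap_Time_ennreal del: cap.simps)
  qed
qed

lemma cap_bounds:
  assumes "0 \<le> t"
  shows "0 \<le> cap t x" "cap t x \<le> t" "Time (ennreal (cap t x)) \<le> x"
  using assms by (cases rule: cap_cases[OF assms, of x]; simp)+

lemma cap_le_iff:
  assumes "0 \<le> r" "r < t"
  shows "cap t x \<le> r \<longleftrightarrow> x \<le> Time (ennreal r)"
proof (cases rule: cap_cases[of t x])
  case 2
  have "\<not> x \<le> Time (ennreal r)"
  proof
    assume "x \<le> Time (ennreal r)"
    with 2(2) have "Time (ennreal t) \<le> Time (ennreal r)" by (rule order_trans)
    then show False using assms by simp
  qed
  then show ?thesis using 2 assms by simp
qed (use assms in \<open>auto simp del: cap.simps\<close>)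

lemma cap_eq:
  assumes "0 \<le> t" "Time (ennreal t) \<le> x"
  shows "cap t x = t"
proof (cases rule: cap_cases[OF assms(1), of x])
  case (2 u)
  then show ?thesis using assms by simp
qed

lemma cap_Lipschitz:
  assumes "0 \<le> r" "r \<le> q"
  shows "cap r x \<le> cap q x" "cap q x \<le> cap r x + (q - r)"
proof -
  have "cap r x \<le> cap q x \<and> cap q x \<le> cap r x + (q - r)"
  proof (cases rule: cap_cases[OF order_trans[OF assms], of x])
    case 1
    have "Time (ennreal r) \<le> Time (ennreal q)" using assms by (simp add: ennreal_leI)
    then have "cap r x = r" using assms by (intro cap_eq order_trans[OF _ 1(2)]) auto
    then show ?thesis using 1 assms by simp
  next
    case (2 u)
    then show ?thesis using assms by (auto simp: cap_Time_ennreal simp del: cap.simps)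
  qed
  then show "cap r x \<le> cap q x" "cap q x \<le> cap r x + (q - r)" by auto
qed

lemma stopped_eq:
  assumes "0 \<le> t"
  shows "stopped \<tau> t \<omega> = \<omega> (cap t (\<tau> \<omega>))"
proof (cases "\<tau> \<omega>")
  case (Time u)
  have "min (ennreal t) u \<noteq> \<infinity>" by (auto simp: min_def)
  then show ?thesis
    using assms Time by (simp add: stopped_def X_def)
qed (simp add: stopped_def)

text \<open>
Rounding up to a multiple of \<open>1 / (k + 1)\<close>, but not beyond \<open>t\<close>. A stopping time rounded in this way
takes finitely many values, is still a stopping time because it was rounded up, and converges to
the original one from the right.
\<close>

definition grid_ceiling :: "nat \<Rightarrow> real \<Rightarrow> real \<Rightarrow> real" where
  "grid_ceiling k t x = min t (of_int \<lceil>x * (1 + real k)\<rceil> / (1 + real k))"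

lemma grid_ceiling_bounds:
  assumes "x \<le> t"
  shows "x \<le> grid_ceiling k t x" "grid_ceiling k t x \<le> t" "grid_ceiling k t x \<le> x + 1 / (1 + real k)"
proof -
  have m: "0 < 1 + real k" by simp
  show "x \<le> grid_ceiling k t x"
    using assms m by (simp add: grid_ceiling_def pos_le_divide_eq)
  show "grid_ceiling k t x \<le> t" by (simp add: grid_ceiling_def)
  have "of_int \<lceil>x * (1 + real k)\<rceil> / (1 + real k) \<le> (x * (1 + real k) + 1) / (1 + real k)"
    by (intro divide_right_mono) (auto simp: of_int_ceiling_le_add_one)
  also have "\<dots> = x + 1 / (1 + real k)"
    using m by (simp add: add_divide_distrib)
  finally show "grid_ceiling k t x \<le> x + 1 / (1 + real k)"
    by (simp add: grid_ceiling_def min_le_iff_disj)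
qed

lemma grid_ceiling_le_iff:
  assumes "r < t"
  shows "grid_ceiling k t x \<le> r \<longleftrightarrow> x \<le> of_int \<lfloor>r * (1 + real k)\<rfloor> / (1 + real k)"
proof -
  have m: "0 < 1 + real k" by simp
  have "grid_ceiling k t x \<le> r \<longleftrightarrow> of_int \<lceil>x * (1 + real k)\<rceil> \<le> r * (1 + real k)"
    using assms m by (simp add: grid_ceiling_def min_le_iff_disj pos_divide_le_eq)
  also have "\<dots> \<longleftrightarrow> x * (1 + real k) \<le> of_int \<lfloor>r * (1 + real k)\<rfloor>"
    by (simp add: le_floor_iff[symmetric] ceiling_le_iff)
  also have "\<dots> \<longleftrightarrow> x \<le> of_int \<lfloor>r * (1 + real k)\<rfloor> / (1 + real k)"
    using m by (simp add: pos_le_divide_eq)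
  finally show ?thesis .
qed

lemma finite_grid: "finite (grid_ceiling k t ` {0..t})"
proof (rule finite_subset)
  show "grid_ceiling k t ` {0..t} \<subseteq>
      insert t ((\<lambda>i. of_int i / (1 + real k)) ` {0..\<lceil>t * (1 + real k)\<rceil>})"
  proof
    fix y assume "y \<in> grid_ceiling k t ` {0..t}"
    then obtain x where x: "0 \<le> x" "x \<le> t" "y = grid_ceiling k t x" by auto
    have "0 \<le> \<lceil>x * (1 + real k)\<rceil>"
      using x by (simp add: le_ceiling_iff) (smt (verit) mult_nonneg_nonneg of_nat_0_le_iff)
    moreover have "\<lceil>x * (1 + real k)\<rceil> \<le> \<lceil>t * (1 + real k)\<rceil>"
      using x by (intro ceiling_mono mult_right_mono) auto
    ultimately show "y \<in> insert t ((\<lambda>i. of_int i / (1 + real k)) ` {0..\<lceil>t * (1 + real k)\<rceil>})"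
      using x(3) by (auto simp: grid_ceiling_def min_def)
  qed
qed simp

lemma grid_ceiling_tendsto:
  assumes "x \<le> t"
  shows "(\<lambda>k. grid_ceiling k t x) \<longlonglongrightarrow> x"
proof (rule tendsto_sandwich[of "\<lambda>_. x" _ _ "\<lambda>k. x + 1 / (1 + real k)"])
  have "(\<lambda>k. 1 / (1 + real k)) \<longlonglongrightarrow> 0"
    using LIMSEQ_inverse_real_of_nat by (simp add: field_simps)
  from tendsto_add[OF tendsto_const[of x] this]
  show "(\<lambda>k. x + 1 / (1 + real k)) \<longlonglongrightarrow> x" by simp
qed (use grid_ceiling_bounds[OF assms] in auto)

lemma C_abs_seq_right_continuous:
  assumes C: "\<omega> \<in> C_abs" and r: "0 \<le> r" and q: "q \<longlonglongrightarrow> r" "\<And>k. r \<le> q k"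
  shows "(\<lambda>k. \<omega> (q k)) \<longlonglongrightarrow> \<omega> r"
proof (rule topological_tendstoI)
  fix U assume "open U" "\<omega> r \<in> U"
  then obtain d where d: "r < d" "\<And>v. r \<le> v \<Longrightarrow> v < d \<Longrightarrow> \<omega> v \<in> U"
    using C_abs_stays_in_open[OF C r] by blast
  have "\<forall>\<^sub>F k in sequentially. q k < d"
    using q(1) d(1) by (rule order_tendstoD)
  then show "\<forall>\<^sub>F k in sequentially. \<omega> (q k) \<in> U"
    by eventually_elim (use d q in auto)
qed

lemma stopped_seq_right_continuous:
  assumes C: "\<omega> \<in> C_abs" and r: "0 \<le> r" and q: "q \<longlonglongrightarrow> r" "\<And>k. r \<le> q k"
  shows "(\<lambda>k. stopped \<tau> (q k) \<omega>) \<longlonglongrightarrow> stopped \<tau> r \<omega>"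
proof -
  have "(\<lambda>k. cap (q k) (\<tau> \<omega>)) \<longlonglongrightarrow> cap r (\<tau> \<omega>)"
  proof (rule tendsto_sandwich[of "\<lambda>_. cap r (\<tau> \<omega>)" _ _ "\<lambda>k. cap r (\<tau> \<omega>) + (q k - r)"])
    show "(\<lambda>k. cap r (\<tau> \<omega>) + (q k - r)) \<longlonglongrightarrow> cap r (\<tau> \<omega>)"
      using tendsto_add[OF tendsto_const[of "cap r (\<tau> \<omega>)"] tendsto_diff[OF q(1) tendsto_const[of r]]] by simp
  qed (use cap_Lipschitz[OF r q(2)] in auto)
  then have "(\<lambda>k. \<omega> (cap (q k) (\<tau> \<omega>))) \<longlonglongrightarrow> \<omega> (cap r (\<tau> \<omega>))"
    using cap_Lipschitz(1)[OF r q(2)] cap_bounds(1)[OF r] by (intro C_abs_seq_right_continuous[OF C])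
  moreover have "0 \<le> q k" for k using r q(2)[of k] by simp
  ultimately show ?thesis using r by (simp add: stopped_eq)
qed

lemma grid_values:
  assumes "0 \<le> t"
  shows "grid_ceiling k t (cap t x) \<in> grid_ceiling k t ` {0..t}"
    and "grid_ceiling k t ` {0..t} \<subseteq> {0..t}"
proof -
  show "grid_ceiling k t (cap t x) \<in> grid_ceiling k t ` {0..t}"
    using cap_bounds[OF assms, of x] by simp
  show "grid_ceiling k t ` {0..t} \<subseteq> {0..t}"
  proof
    fix y assume "y \<in> grid_ceiling k t ` {0..t}"
    then obtain x where x: "0 \<le> x" "x \<le> t" "y = grid_ceiling k t x" by auto
    then show "y \<in> {0..t}"
      using grid_ceiling_bounds(1,2)[OF x(2), of k] by simp
  qed
qed

lemma grid_stopping_time: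
  assumes \<sigma>: "is_stopping_time \<sigma>" and t: "0 \<le> t" and v: "0 \<le> v" "v \<le> t"
  shows "{\<omega> \<in> C_abs. grid_ceiling k t (cap t (\<sigma> \<omega>)) = v} \<in> sets (Filt v)"
proof -
  let ?G = "\<lambda>\<omega>. grid_ceiling k t (cap t (\<sigma> \<omega>))"
  define V where "V = grid_ceiling k t ` {0..t}"
  have le: "{\<omega> \<in> C_abs. ?G \<omega> \<le> r} \<in> sets (Filt v)" if r: "0 \<le> r" "r \<le> v" for r
  proof (cases "r < t")
    case False
    then have "{\<omega> \<in> C_abs. ?G \<omega> \<le> r} = space (Filt v)"
      using order_trans[OF grid_ceiling_bounds(2)[OF cap_bounds(2)[OF t]], of r] by auto
    then show ?thesis by (simp del: space_Filt)
  next
    case True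
    let ?f = "of_int \<lfloor>r * (1 + real k)\<rfloor> / (1 + real k)"
    have f: "0 \<le> ?f" "?f \<le> r"
      using r by (auto simp: pos_divide_le_eq)
    have "{\<omega> \<in> C_abs. ?G \<omega> \<le> r} = {\<omega> \<in> C_abs. \<sigma> \<omega> \<le> Time (ennreal ?f)}"
      using grid_ceiling_le_iff[OF True] cap_le_iff[of ?f t] f True by simp
    then show ?thesis
      using \<sigma> f r sets_Filt_mono[of ?f v] unfolding is_stopping_time_def by auto
  qed
  have "{\<omega> \<in> C_abs. ?G \<omega> = v} = {\<omega> \<in> C_abs. ?G \<omega> \<le> v} - (\<Union>r\<in>{r \<in> V. r < v}. {\<omega> \<in> C_abs. ?G \<omega> \<le> r})"
    using grid_values(1)[OF t, of k] unfolding V_def[symmetric] by (auto simp: order.strict_iff_order)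
  moreover have "0 \<le> r" if "r \<in> V" for r
    using that grid_values(2)[OF t, of k] unfolding V_def by auto
  then have "(\<Union>r\<in>{r \<in> V. r < v}. {\<omega> \<in> C_abs. ?G \<omega> \<le> r}) \<in> sets (Filt v)"
    using finite_grid[of k t] unfolding V_def[symmetric] by (intro sets.finite_UN le) auto
  ultimately show ?thesis using le[of v] v by auto
qed

lemma stopped_measurable:
  assumes \<sigma>: "is_stopping_time \<sigma>" and t: "0 \<le> t"
  shows "stopped \<sigma> t \<in> borel_measurable (Filt t)"
proof (rule borel_measurable_LIMSEQ_order)
  let ?G = "\<lambda>k \<omega>. grid_ceiling k t (cap t (\<sigma> \<omega>))"
  show "(\<lambda>k. \<omega> (?G k \<omega>)) \<longlonglongrightarrow> stopped \<sigma> t \<omega>" if "\<omega> \<in> space (Filt t)" for \<omega>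
    using that cap_bounds[OF t, of "\<sigma> \<omega>"] unfolding stopped_eq[OF t]
    by (intro C_abs_seq_right_continuous grid_ceiling_tendsto grid_ceiling_bounds(1)) auto
  show "(\<lambda>\<omega>. \<omega> (?G k \<omega>)) \<in> borel_measurable (Filt t)" for k
  proof (rule measurableI)
    fix B :: "ennreal set" assume B: "B \<in> sets borel"
    define V where "V = grid_ceiling k t ` {0..t}"
    have "(\<lambda>\<omega>. \<omega> (?G k \<omega>)) -` B \<inter> space (Filt t) =
        (\<Union>v\<in>V. {\<omega> \<in> C_abs. ?G k \<omega> = v} \<inter> {\<omega> \<in> space (Filt t). \<omega> v \<in> B})"
      using grid_values(1)[OF t, of k] unfolding V_def[symmetric] by auto
    also have "\<dots> \<in> sets (Filt t)"
    proof (intro sets.finite_UN sets.Int)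
      show "finite V" unfolding V_def by (rule finite_grid)
      fix v assume "v \<in> V"
      then have v: "0 \<le> v" "v \<le> t" using grid_values(2)[OF t, of k] unfolding V_def by auto
      show "{\<omega> \<in> C_abs. ?G k \<omega> = v} \<in> sets (Filt t)"
        using grid_stopping_time[OF \<sigma> t v] sets_Filt_mono[OF v(2)] by auto
      show "{\<omega> \<in> space (Filt t). \<omega> v \<in> B} \<in> sets (Filt t)"
        by (intro level_sets_measurable eval_measurable_Filt v B)
    qed
    finally show "(\<lambda>\<omega>. \<omega> (?G k \<omega>)) -` B \<inter> space (Filt t) \<in> sets (Filt t)" .
  qed simp
qed

text \<open>
On \<open>{\<tau> \<le> t}\<close> the variable \<open>X\<^sub>\<tau>\<close> is the value of the stopped process at \<open>t\<close>; where \<open>\<tau>\<close> is not finite, it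
is \<open>X\<^sub>\<infinity>\<close>.
\<close>

lemma X_at_measurable:
  assumes \<sigma>: "is_stopping_time \<sigma>"
  shows "X_at \<sigma> \<in> borel_measurable (Filt_at \<sigma>)"
proof (rule measurableI)
  fix B :: "ennreal set" assume B: "B \<in> sets borel"
  let ?S = "\<lambda>t. {\<omega> \<in> C_abs. \<sigma> \<omega> \<le> Time (ennreal t)}"
  let ?A = "X_at \<sigma> -` B \<inter> space (Filt_at \<sigma>)"
  have S: "?S t \<in> sets (Filt t)" if "0 \<le> t" for t
    using \<sigma> that by (simp add: is_stopping_time_def)
  have "X_at \<sigma> \<omega> = stopped \<sigma> t \<omega>" if le: "\<sigma> \<omega> \<le> Time (ennreal t)" and t: "0 \<le> t" for \<omega> t
  proof -
    obtain v where v: "\<sigma> \<omega> = Time v" "v \<le> ennreal t" using le by (cases "\<sigma> \<omega>") auto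
    then obtain u where u: "0 \<le> u" "v = ennreal u" by (cases v) (auto simp: top_unique)
    then have "u \<le> t" using v t by simp
    then show ?thesis
      using X_at_finite[of \<sigma> \<omega> u] u v t by (simp add: stopped_eq cap_Time_ennreal min_absorb2 del: cap.simps)
  qed
  then have fin: "?A \<inter> ?S t = {\<omega> \<in> space (Filt t). stopped \<sigma> t \<omega> \<in> B} \<inter> ?S t" if "0 \<le> t" for t
    using that by auto
  have part: "?A \<inter> ?S t \<in> sets (Filt t)" if t: "0 \<le> t" for t
    unfolding fin[OF t] by (intro sets.Int level_sets_measurable stopped_measurable[OF \<sigma> t] B S t)
  have inf: "X_at \<sigma> \<omega> = path_at_inf \<omega>" if "\<omega> \<in> C_abs" "\<omega> \<notin> (\<Union>n. ?S (real n))" for \<omega>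
  proof (rule X_at_infinite, rule ccontr)
    assume "\<not> (\<sigma> \<omega> = Time \<infinity> \<or> \<sigma> \<omega> = Beyond)"
    then obtain u where u: "0 \<le> u" "\<sigma> \<omega> = Time (ennreal u)"
      by (metis ennreal_cases infinity_ennreal_def xtime.exhaust)
    have "u \<le> real (nat \<lceil>u\<rceil>)" by linarith
    then have "\<omega> \<in> ?S (real (nat \<lceil>u\<rceil>))" using that(1) u by (simp add: ennreal_leI)
    then show False using that(2) by blast
  qed
  have "?A = (\<Union>n. ?A \<inter> ?S (real n)) \<union> ({\<omega> \<in> space Filt_inf. path_at_inf \<omega> \<in> B} - (\<Union>n. ?S (real n)))"
    (is "?A = ?U \<union> (?P - ?W)")
  proof (intro set_eqI)
    fix \<omega>
    show "\<omega> \<in> ?A \<longleftrightarrow> \<omega> \<in> ?U \<union> (?P - ?W)"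
      using inf[of \<omega>] by (cases "\<omega> \<in> ?W") auto
  qed
  also have "\<dots> \<in> sets Filt_inf"
    using part S sets_Filt_subset of_nat_0_le_iff
    by (intro sets.Un sets.Diff sets.countable_UN level_sets_measurable path_at_inf_measurable B) blast+
  finally show "?A \<in> sets (Filt_at \<sigma>)"
    unfolding sets_Filt_at_iff[OF \<sigma>] using part by blast
qed simp

section \<open>Optional stopping\<close>

lemma cap_cap:
  assumes "0 \<le> t"
  shows "cap (cap t x) y = cap t (min y x)"
proof (cases rule: cap_cases[OF assms, of x])
  case 1
  have "cap t (min y x) = cap t y"
  proof (cases "y \<le> x")
    case False
    then have "cap t y = t" using 1(2) assms by (intro cap_eq order_trans[OF 1(2)]) auto
    then show ?thesis using 1(1) False by simp
  qed simp
  then show ?thesis using 1 by simp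
next
  case u: (2 u)
  show ?thesis
  proof (cases rule: cap_cases[OF u(1), of y])
    case 1
    then have "min y x = x" using u by (simp add: min_absorb2)
    then show ?thesis using 1 u by simp
  next
    case v: (2 v)
    then have "min y x = y" using u(3) by (simp add: min_absorb1 ennreal_leI)
    moreover have "cap t y = v" using v u(2) by (simp add: cap_Time_ennreal del: cap.simps)
    ultimately show ?thesis using v(4) u(4) by simp
  qed
qed

locale path_prob_space = prob_space P for P :: "path measure" +
  assumes sets_P: "sets P = sets Filt_inf"
begin

lemma space_P: "space P = C_abs"
  using sets_eq_imp_space_eq[OF sets_P] by simp

lemma subalgebra_Filt: "0 \<le> t \<Longrightarrow> subalgebra P (Filt t)"
  using sets_Filt_subset by (simp add: subalgebra_def space_P sets_P)

lemma Filt_sets: "0 \<le> t \<Longrightarrow> A \<in> sets (Filt t) \<Longrightarrow> A \<in> sets P"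
  using sets_Filt_subset sets_P by auto

lemma Filt_measurable: "0 \<le> t \<Longrightarrow> f \<in> borel_measurable (Filt t) \<Longrightarrow> f \<in> borel_measurable P"
  using measurable_from_subalg[OF subalgebra_Filt] by blast

lemma martingale_set_integral:
  assumes mart: "is_martingale P Y" and st: "0 \<le> s" "s \<le> t" and A: "A \<in> sets (Filt s)"
  shows "(\<integral>\<^sup>+\<omega>\<in>A. Y t \<omega> \<partial>P) = (\<integral>\<^sup>+\<omega>\<in>A. Y s \<omega> \<partial>P)"
proof -
  interpret F: finite_measure_subalgebra P "Filt s"
    by unfold_locales (rule subalgebra_Filt[OF st(1)])
  have Yt: "Y t \<in> borel_measurable P"
    using mart st by (intro Filt_measurable[of t]) (auto simp: is_martingale_def)
  have ae: "AE \<omega> in P. nn_cond_exp P (Filt s) (Y t) \<omega> = Y s \<omega>"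
    using mart st by (auto simp: is_martingale_def)
  have "(\<integral>\<^sup>+\<omega>\<in>A. Y t \<omega> \<partial>P) = (\<integral>\<^sup>+\<omega>. indicator A \<omega> * nn_cond_exp P (Filt s) (Y t) \<omega> \<partial>P)"
    using F.nn_cond_exp_intg[of "indicator A" "Y t"] A Yt by (simp add: mult.commute)
  also have "\<dots> = (\<integral>\<^sup>+\<omega>\<in>A. Y s \<omega> \<partial>P)"
    by (intro nn_integral_cong_AE) (use ae in eventually_elim, simp add: mult.commute)
  finally show ?thesis .
qed

lemma martingaleI:
  assumes meas: "\<And>t. 0 \<le> t \<Longrightarrow> Y t \<in> borel_measurable (Filt t)"
    and int: "\<And>t. 0 \<le> t \<Longrightarrow> (\<integral>\<^sup>+\<omega>. Y t \<omega> \<partial>P) < \<infinity>"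
    and eq: "\<And>s t A. 0 \<le> s \<Longrightarrow> s \<le> t \<Longrightarrow> A \<in> sets (Filt s) \<Longrightarrow>
      (\<integral>\<^sup>+\<omega>\<in>A. Y t \<omega> \<partial>P) = (\<integral>\<^sup>+\<omega>\<in>A. Y s \<omega> \<partial>P)"
  shows "is_martingale P Y"
  unfolding is_martingale_def
proof (intro conjI allI impI)
  fix s t :: real assume st: "0 \<le> s" "s \<le> t"
  interpret F: finite_measure_subalgebra P "Filt s"
    by unfold_locales (rule subalgebra_Filt[OF st(1)])
  have "AE \<omega> in P. Y s \<omega> = nn_cond_exp P (Filt s) (Y t) \<omega>"
  proof (rule F.nn_cond_exp_charact)
    show "(\<integral>\<^sup>+\<omega>\<in>A. Y t \<omega> \<partial>P) = (\<integral>\<^sup>+\<omega>\<in>A. Y s \<omega> \<partial>P)" if "A \<in> sets (Filt s)" for A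
      using eq[OF st that] .
    have "0 \<le> t" using st by simp
    then show "Y t \<in> borel_measurable P" using Filt_measurable meas by blast
    show "Y s \<in> borel_measurable (Filt s)" by (rule meas[OF st(1)])
  qed
  then show "AE \<omega> in P. nn_cond_exp P (Filt s) (Y t) \<omega> = Y s \<omega>"
    by eventually_elim simp
qed (use meas int in auto)

text \<open>
Let \<open>M = X\<^sup>\<tau>\<close>, and let \<open>h\<^sub>k\<close> be \<open>M\<close> at the time \<open>\<sigma> \<and> t\<close> rounded up to the \<open>k\<close>-th grid. Summation over the
finitely many values of the rounded time gives \<open>E[h\<^sub>k; A, h\<^sub>k \<le> L] = E[M\<^sub>t; A, h\<^sub>k \<le> L]\<close> for every \<open>L\<close>,
since \<open>{h\<^sub>k \<le> L}\<close> is, on each piece, an event of the sigma-algebra of the corresponding grid time.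
The restriction to \<open>{h\<^sub>k \<le> L}\<close> makes dominated convergence applicable, with the bound \<open>L\<close> on the
left-hand side and \<open>M\<^sub>t\<close> on the right-hand side, although the \<open>h\<^sub>k\<close> themselves may overshoot \<open>K\<close>. Their
limit is bounded by \<open>K\<close>, so for \<open>L > K\<close> the restriction disappears as \<open>k \<rightarrow> \<infinity>\<close>.
\<close>

lemma optional_stopping:
  assumes mart: "is_martingale P (stopped \<tau>)" and \<sigma>: "is_stopping_time \<sigma>"
    and st: "0 \<le> s" "s \<le> t" and A: "A \<in> sets (Filt s)"
    and after: "\<And>\<omega>. \<omega> \<in> A \<Longrightarrow> \<not> \<sigma> \<omega> \<le> Time (ennreal s)"
    and bound: "AE \<omega> in P. stopped \<tau> (cap t (\<sigma> \<omega>)) \<omega> \<le> K" and K: "K < \<infinity>"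
  shows "(\<integral>\<^sup>+\<omega>\<in>A. stopped \<tau> (cap t (\<sigma> \<omega>)) \<omega> \<partial>P) = (\<integral>\<^sup>+\<omega>\<in>A. stopped \<tau> s \<omega> \<partial>P)"
proof -
  let ?M = "stopped \<tau>"
  have t: "0 \<le> t" using st by simp
  define G where "G k \<omega> = grid_ceiling k t (cap t (\<sigma> \<omega>))" for k \<omega>
  define V where "V k = grid_ceiling k t ` {0..t}" for k
  define h where "h k \<omega> = ?M (G k \<omega>) \<omega>" for k \<omega>
  define L where "L = K + 1"
  define C where "C k = {\<omega> \<in> A. h k \<omega> \<le> L}" for k
  define B where "B k v = A \<inter> {\<omega> \<in> C_abs. G k \<omega> = v} \<inter> {\<omega> \<in> space (Filt v). ?M v \<omega> \<in> {..L}}" for k v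
  have A_sub: "A \<subseteq> C_abs" using sets.sets_into_space[OF A] by simp
  have V: "finite (V k)" "\<And>v. v \<in> V k \<Longrightarrow> 0 \<le> v \<and> v \<le> t" "G k \<omega> \<in> V k" for k \<omega>
    using finite_grid grid_values[OF t, of k] unfolding V_def G_def by auto
  have M: "?M v \<in> borel_measurable (Filt v)" if "0 \<le> v" for v
    using mart that by (auto simp: is_martingale_def)
  note MP = Filt_measurable[OF _ M]
  have G_sets: "{\<omega> \<in> C_abs. G k \<omega> = v} \<in> sets (Filt v)" if "v \<in> V k" for k v
    unfolding G_def using V(2)[OF that] by (intro grid_stopping_time \<sigma> t) auto
  have G_ge: "s \<le> G k \<omega>" if "\<omega> \<in> A" for k \<omega>
  proof -
    have "s \<le> cap t (\<sigma> \<omega>)"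
    proof (rule ccontr)
      assume *: "\<not> s \<le> cap t (\<sigma> \<omega>)"
      then have "Time (ennreal (cap t (\<sigma> \<omega>))) \<le> Time (ennreal s)" by (simp add: ennreal_leI)
      moreover have "\<sigma> \<omega> \<le> Time (ennreal (cap t (\<sigma> \<omega>)))"
        using cap_bounds(1)[OF t] * st by (subst cap_le_iff[symmetric, of _ t]) auto
      ultimately show False using after[OF that] by (metis order_trans)
    qed
    also have "\<dots> \<le> G k \<omega>"
      unfolding G_def by (rule grid_ceiling_bounds(1)[OF cap_bounds(2)[OF t]])
    finally show ?thesis .
  qed
  have B: "B k v \<in> sets (Filt v)" if v: "v \<in> V k" for k v
  proof (cases "s \<le> v")
    case True
    then have "A \<in> sets (Filt v)" using A sets_Filt_mono[of s v] by auto
    then show ?thesis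
      unfolding B_def using conjunct1[OF V(2)[OF v]]
      by (intro sets.Int G_sets v level_sets_measurable M) simp_all
  next
    case False
    then have "B k v = {}" unfolding B_def using G_ge by auto
    then show ?thesis by simp
  qed
  \<comment> \<open>\<open>A \<inter> {h k \<le> L}\<close> is split according to the grid time, and the piece at \<open>v\<close> is an event of time \<open>v\<close>.\<close>
  have ind_C: "f (G k \<omega>) * indicator (C k) \<omega> = (\<Sum>v\<in>V k. f v * indicator (B k v) \<omega>)"
    if "\<omega> \<in> C_abs" for f :: "real \<Rightarrow> ennreal" and k \<omega>
  proof -
    have "(\<Sum>v\<in>V k. f v * indicator (B k v) \<omega>) =
        (\<Sum>v\<in>V k. if v = G k \<omega> then f (G k \<omega>) * indicator (C k) \<omega> else 0)"
      using that by (intro sum.cong) (auto simp: B_def C_def h_def split: split_indicator)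
    then show ?thesis using V by simp
  qed
  have B_P: "B k v \<in> sets P" if "v \<in> V k" for k v
    using B[OF that] Filt_sets V(2)[OF that] by blast
  have hC: "(\<lambda>\<omega>. h k \<omega> * indicator (C k) \<omega>) \<in> borel_measurable P" for k
  proof -
    have "(\<lambda>\<omega>. \<Sum>v\<in>V k. ?M v \<omega> * indicator (B k v) \<omega>) \<in> borel_measurable P"
      using MP V(2) B_P by (intro borel_measurable_sum borel_measurable_times_ennreal borel_measurable_indicator) auto
    then show ?thesis
      by (rule measurable_cong[THEN iffD1, rotated]) (simp add: ind_C[symmetric] h_def space_P)
  qed
  have C_P: "C k \<in> sets P" for k
  proof -
    have "(\<lambda>\<omega>. \<Sum>v\<in>V k. 1 * indicator (B k v) \<omega> :: ennreal) \<in> borel_measurable P"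
      using V(2) B_P by (intro borel_measurable_sum borel_measurable_times_ennreal borel_measurable_indicator) auto
    then have "(\<lambda>\<omega>. indicator (C k) \<omega> :: ennreal) \<in> borel_measurable P"
      by (rule measurable_cong[THEN iffD1, rotated])
        (use ind_C[of _ "\<lambda>_. 1" k] in \<open>simp add: space_P\<close>)
    then show ?thesis
      using A_sub by (subst (asm) borel_measurable_indicator_iff) (auto simp: space_P C_def Int_absorb2 subset_eq)
  qed
  have step: "(\<integral>\<^sup>+\<omega>. h k \<omega> * indicator (C k) \<omega> \<partial>P) = (\<integral>\<^sup>+\<omega>. ?M t \<omega> * indicator (C k) \<omega> \<partial>P)" for k
  proof -
    have "(\<integral>\<^sup>+\<omega>. h k \<omega> * indicator (C k) \<omega> \<partial>P) = (\<integral>\<^sup>+\<omega>. (\<Sum>v\<in>V k. ?M v \<omega> * indicator (B k v) \<omega>) \<partial>P)"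
      by (intro nn_integral_cong) (simp add: ind_C[symmetric] h_def space_P)
    also have "\<dots> = (\<Sum>v\<in>V k. \<integral>\<^sup>+\<omega>. ?M v \<omega> * indicator (B k v) \<omega> \<partial>P)"
      using MP V(2) B_P by (intro nn_integral_sum borel_measurable_times_ennreal borel_measurable_indicator) auto
    also have "\<dots> = (\<Sum>v\<in>V k. \<integral>\<^sup>+\<omega>. ?M t \<omega> * indicator (B k v) \<omega> \<partial>P)"
      using V(2) by (intro sum.cong refl martingale_set_integral[OF mart, symmetric] B) auto
    also have "\<dots> = (\<integral>\<^sup>+\<omega>. (\<Sum>v\<in>V k. ?M t \<omega> * indicator (B k v) \<omega>) \<partial>P)"
      using MP[OF t t] B_P by (intro nn_integral_sum[symmetric] borel_measurable_times_ennreal borel_measurable_indicator) auto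
    also have "\<dots> = (\<integral>\<^sup>+\<omega>. ?M t \<omega> * indicator (C k) \<omega> \<partial>P)"
      by (intro nn_integral_cong) (simp add: ind_C[symmetric, of _ "\<lambda>_. ?M t _"] space_P)
    finally show ?thesis .
  qed
  have h_lim: "(\<lambda>k. h k \<omega>) \<longlonglongrightarrow> ?M (cap t (\<sigma> \<omega>)) \<omega>" if "\<omega> \<in> C_abs" for \<omega>
    unfolding h_def G_def using that cap_bounds[OF t]
    by (intro stopped_seq_right_continuous grid_ceiling_tendsto grid_ceiling_bounds(1)) auto
  have "K < L" unfolding L_def using K by (cases K) (auto simp: ennreal_less_iff ennreal_plus[symmetric] ennreal_1[symmetric] simp del: ennreal_plus ennreal_1)
  have L: "L < \<infinity>" unfolding L_def using K by (simp add: less_top[symmetric])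
  have ev_C: "AE \<omega> in P. \<forall>\<^sub>F k in sequentially. indicator (C k) \<omega> = (indicator A \<omega> :: ennreal)"
    using bound AE_space
  proof eventually_elim
    case (elim \<omega>)
    then have "\<forall>\<^sub>F k in sequentially. h k \<omega> < L"
      using \<open>K < L\<close> by (intro order_tendstoD(2)[OF h_lim]) (auto simp: space_P)
    then show ?case by eventually_elim (auto simp: C_def split: split_indicator)
  qed
  have A_P: "A \<in> sets P" using Filt_sets[OF st(1) A] .
  have "(\<lambda>k. \<integral>\<^sup>+\<omega>. ?M t \<omega> * indicator (C k) \<omega> \<partial>P) \<longlonglongrightarrow> (\<integral>\<^sup>+\<omega>. ?M t \<omega> * indicator A \<omega> \<partial>P)"
  proof (rule nn_integral_dominated_convergence[where w = "?M t"])
    show "(\<integral>\<^sup>+\<omega>. ?M t \<omega> \<partial>P) < \<infinity>" using mart t by (auto simp: is_martingale_def)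
    show "AE \<omega> in P. (\<lambda>k. ?M t \<omega> * indicator (C k) \<omega>) \<longlonglongrightarrow> ?M t \<omega> * indicator A \<omega>"
      using ev_C by eventually_elim (auto intro!: tendsto_eventually elim!: eventually_mono)
  qed (use MP[OF t t] C_P A_P in \<open>auto split: split_indicator\<close>)
  moreover have "(\<lambda>k. \<integral>\<^sup>+\<omega>. h k \<omega> * indicator (C k) \<omega> \<partial>P) \<longlonglongrightarrow> (\<integral>\<^sup>+\<omega>. ?M (cap t (\<sigma> \<omega>)) \<omega> * indicator A \<omega> \<partial>P)"
  proof (rule nn_integral_dominated_convergence[where w = "\<lambda>_. L"])
    have lim: "AE \<omega> in P. (\<lambda>k. h k \<omega> * indicator (C k) \<omega>) \<longlonglongrightarrow> ?M (cap t (\<sigma> \<omega>)) \<omega> * indicator A \<omega>"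
      using ev_C AE_space
    proof eventually_elim
      case (elim \<omega>)
      have "(\<lambda>k. h k \<omega> * indicator A \<omega>) \<longlonglongrightarrow> ?M (cap t (\<sigma> \<omega>)) \<omega> * indicator A \<omega>"
        using h_lim[of \<omega>] elim(2) by (auto simp: space_P split: split_indicator)
      then show ?case
        by (rule Lim_transform_eventually) (use elim(1) in \<open>auto elim!: eventually_mono\<close>)
    qed
    show "AE \<omega> in P. (\<lambda>k. h k \<omega> * indicator (C k) \<omega>) \<longlonglongrightarrow> ?M (cap t (\<sigma> \<omega>)) \<omega> * indicator A \<omega>"
      by (rule lim)
    have "(\<lambda>\<omega>. ?M (cap t (\<sigma> \<omega>)) \<omega>) \<in> borel_measurable P"
    proof (rule borel_measurable_LIMSEQ_order)
      show "(\<lambda>\<omega>. h k \<omega>) \<in> borel_measurable P" for k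
      proof -
        have "(\<lambda>\<omega>. \<Sum>v\<in>V k. ?M v \<omega> * indicator {\<omega> \<in> C_abs. G k \<omega> = v} \<omega>) \<in> borel_measurable P"
        proof (intro borel_measurable_sum borel_measurable_times_ennreal borel_measurable_indicator)
          fix v assume v: "v \<in> V k"
          then have "0 \<le> v" using V(2) by blast
          then show "?M v \<in> borel_measurable P" "{\<omega> \<in> C_abs. G k \<omega> = v} \<in> sets P"
            using MP Filt_sets G_sets[OF v] by blast+
        qed
        moreover have "h k \<omega> = (\<Sum>v\<in>V k. ?M v \<omega> * indicator {\<omega> \<in> C_abs. G k \<omega> = v} \<omega>)" if "\<omega> \<in> C_abs" for \<omega>
        proof -
          have "(\<Sum>v\<in>V k. ?M v \<omega> * indicator {\<omega> \<in> C_abs. G k \<omega> = v} \<omega>) =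
              (\<Sum>v\<in>V k. if v = G k \<omega> then h k \<omega> else 0)"
            using that by (intro sum.cong) (auto simp: h_def)
          then show ?thesis using V by simp
        qed
        ultimately show ?thesis
          by (subst measurable_cong) (auto simp: space_P)
      qed
    qed (use h_lim in \<open>simp add: space_P\<close>)
    then show "(\<lambda>\<omega>. ?M (cap t (\<sigma> \<omega>)) \<omega> * indicator A \<omega>) \<in> borel_measurable P"
      using A_P by simp
    show "(\<integral>\<^sup>+ \<omega>. L \<partial>P) < \<infinity>" using L by (simp add: emeasure_space_1)
  qed (use hC in \<open>auto simp: C_def split: split_indicator\<close>)
  ultimately have "(\<integral>\<^sup>+\<omega>\<in>A. ?M (cap t (\<sigma> \<omega>)) \<omega> \<partial>P) = (\<integral>\<^sup>+\<omega>\<in>A. ?M t \<omega> \<partial>P)"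
    using step LIMSEQ_unique by simp
  also have "\<dots> = (\<integral>\<^sup>+\<omega>\<in>A. ?M s \<omega> \<partial>P)"
    by (rule martingale_set_integral[OF mart st A])
  finally show ?thesis .
qed

text \<open>
Optional stopping at \<open>\<sigma>\<close> is applied to each \<open>X\<^bsup>\<tau>\<^sub>n\<^esup>\<close> of a localizing sequence. As \<open>n \<rightarrow> \<infinity>\<close> both sides
converge by dominated convergence, because nothing exceeds \<open>K\<close> up to time \<open>\<sigma>\<close>. The value at time \<open>s\<close>
is bounded only if \<open>\<sigma>\<close> has not occurred before \<open>s\<close>, which is why the part of \<open>A\<close> with \<open>\<sigma> \<le> s\<close>, on which
the stopped process no longer moves, is split off.
\<close>

lemma bounded_stopped_martingale:
  assumes X: "X_is_local_martingale P" and \<sigma>: "is_stopping_time \<sigma>" and K: "K < \<infinity>"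
    and bound: "AE \<omega> in P. \<forall>v\<ge>0. Time (ennreal v) \<le> \<sigma> \<omega> \<longrightarrow> \<omega> v \<le> K"
  shows "is_martingale P (stopped \<sigma>)" "is_uniformly_integrable P (stopped \<sigma>)"
proof -
  obtain \<tau> where \<tau>: "\<And>n. is_stopping_time (\<tau> n)"
      "AE \<omega> in P. \<forall>t\<ge>0. \<forall>\<^sub>F n in sequentially. Time (ennreal t) < \<tau> n \<omega>"
      "\<And>n. is_martingale P (stopped (\<tau> n))"
    using X unfolding X_is_local_martingale_def by blast
  have le: "AE \<omega> in P. stopped \<sigma> t \<omega> \<le> K" if "0 \<le> t" for t
    using bound by eventually_elim (use cap_bounds[OF that] that in \<open>simp add: stopped_eq\<close>)
  note meas = stopped_measurable[OF \<sigma>]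
  have measP: "stopped \<tau>' t \<in> borel_measurable P" if "is_stopping_time \<tau>'" "0 \<le> t" for \<tau>' t
    using Filt_measurable[OF that(2)] stopped_measurable[OF that] .
  show "is_martingale P (stopped \<sigma>)"
  proof (rule martingaleI)
    fix t :: real assume t: "0 \<le> t"
    have "(\<integral>\<^sup>+\<omega>. stopped \<sigma> t \<omega> \<partial>P) \<le> (\<integral>\<^sup>+\<omega>. K \<partial>P)"
      by (rule nn_integral_mono_AE[OF le[OF t]])
    then show "(\<integral>\<^sup>+\<omega>. stopped \<sigma> t \<omega> \<partial>P) < \<infinity>"
      using K by (simp add: emeasure_space_1)
  next
    fix s t :: real and A assume st: "0 \<le> s" "s \<le> t" and A: "A \<in> sets (Filt s)"
    have t: "0 \<le> t" using st by simp
    have A_sub: "A \<subseteq> C_abs" using sets.sets_into_space[OF A] by simp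
    let ?S = "{\<omega> \<in> C_abs. \<sigma> \<omega> \<le> Time (ennreal s)}"
    define A' where "A' = A - ?S"
    have S: "?S \<in> sets (Filt s)" using \<sigma> st by (auto simp: is_stopping_time_def)
    have A': "A' \<in> sets (Filt s)" unfolding A'_def using A S by blast
    have A'P: "A' \<in> sets P" by (rule Filt_sets[OF st(1) A'])
    have AS: "A \<inter> ?S \<in> sets P" using A S by (intro Filt_sets[OF st(1)]) blast
    have after: "\<not> \<sigma> \<omega> \<le> Time (ennreal s)" if "\<omega> \<in> A'" for \<omega>
      using that A_sub by (auto simp: A'_def)
    have bd: "AE \<omega> in P. stopped (\<tau> n) (cap t (\<sigma> \<omega>)) \<omega> \<le> K" for n
      using bound
    proof eventually_elim
      case (elim \<omega>)
      note c = cap_bounds[OF t, of "\<sigma> \<omega>"]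
      have "Time (ennreal (cap (cap t (\<sigma> \<omega>)) (\<tau> n \<omega>))) \<le> Time (ennreal (cap t (\<sigma> \<omega>)))"
        using cap_bounds(2)[OF c(1)] by (simp add: ennreal_leI)
      also note c(3)
      finally show ?case
        using elim cap_bounds(1)[OF c(1)] by (simp add: stopped_eq[OF c(1)])
    qed
    have eq: "(\<integral>\<^sup>+\<omega>\<in>A'. stopped (\<tau> n) (cap t (\<sigma> \<omega>)) \<omega> \<partial>P) = (\<integral>\<^sup>+\<omega>\<in>A'. stopped (\<tau> n) s \<omega> \<partial>P)" for n
      using optional_stopping[OF \<tau>(3) \<sigma> st A' after bd K] .
    have lim: "AE \<omega> in P. \<forall>q\<in>{0..t}. (\<lambda>n. stopped (\<tau> n) q \<omega>) \<longlonglongrightarrow> \<omega> q"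
      using \<tau>(2)
    proof eventually_elim
      case (elim \<omega>)
      show ?case
      proof
        fix q assume q: "q \<in> {0..t}"
        then have "\<forall>\<^sub>F n in sequentially. Time (ennreal q) < \<tau> n \<omega>" using elim by simp
        then have "\<forall>\<^sub>F n in sequentially. stopped (\<tau> n) q \<omega> = \<omega> q"
          by eventually_elim (use q cap_eq in \<open>simp add: stopped_eq\<close>)
        then show "(\<lambda>n. stopped (\<tau> n) q \<omega>) \<longlonglongrightarrow> \<omega> q" by (rule tendsto_eventually)
      qed
    qed
    have L: "(\<lambda>n. \<integral>\<^sup>+\<omega>\<in>A'. stopped (\<tau> n) (cap t (\<sigma> \<omega>)) \<omega> \<partial>P) \<longlonglongrightarrow> (\<integral>\<^sup>+\<omega>\<in>A'. stopped \<sigma> t \<omega> \<partial>P)"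
    proof (rule nn_integral_dominated_convergence[where w = "\<lambda>_. K"])
      show "AE \<omega> in P. stopped (\<tau> n) (cap t (\<sigma> \<omega>)) \<omega> * indicator A' \<omega> \<le> K" for n
        using bd by eventually_elim (auto split: split_indicator)
      show "AE \<omega> in P. (\<lambda>n. stopped (\<tau> n) (cap t (\<sigma> \<omega>)) \<omega> * indicator A' \<omega>) \<longlonglongrightarrow> stopped \<sigma> t \<omega> * indicator A' \<omega>"
        using lim by eventually_elim
          (use cap_bounds[OF t] in \<open>auto simp: stopped_eq[OF t] split: split_indicator\<close>)
      have "(\<lambda>\<omega>. stopped (\<tau> n) (cap t (\<sigma> \<omega>)) \<omega>) \<in> borel_measurable P" for n
      proof -
        have "(\<lambda>\<omega>. stopped (\<tau> n) (cap t (\<sigma> \<omega>)) \<omega>) = stopped (\<lambda>\<omega>. min (\<tau> n \<omega>) (\<sigma> \<omega>)) t"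
          by (rule ext) (simp add: stopped_eq[OF t] stopped_eq[OF cap_bounds(1)[OF t]] cap_cap[OF t])
        then show ?thesis
          using measP[OF stopping_time_min[OF \<tau>(1)[of n] \<sigma>] t] by simp
      qed
      then show "(\<lambda>\<omega>. stopped (\<tau> n) (cap t (\<sigma> \<omega>)) \<omega> * indicator A' \<omega>) \<in> borel_measurable P" for n
        by (intro borel_measurable_times_ennreal borel_measurable_indicator A'P)
      show "(\<integral>\<^sup>+\<omega>. K \<partial>P) < \<infinity>" using K by (simp add: emeasure_space_1)
    qed (intro borel_measurable_const borel_measurable_times_ennreal borel_measurable_indicator A'P measP \<sigma> t)+
    have R: "(\<lambda>n. \<integral>\<^sup>+\<omega>\<in>A'. stopped (\<tau> n) s \<omega> \<partial>P) \<longlonglongrightarrow> (\<integral>\<^sup>+\<omega>\<in>A'. stopped \<sigma> s \<omega> \<partial>P)"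
    proof (rule nn_integral_dominated_convergence[where w = "\<lambda>_. K"])
      show "AE \<omega> in P. stopped (\<tau> n) s \<omega> * indicator A' \<omega> \<le> K" for n
        using bound
      proof eventually_elim
        case (elim \<omega>)
        have "Time (ennreal (cap s (\<tau> n \<omega>))) \<le> Time (ennreal s)"
          using cap_bounds(2)[OF st(1)] by (simp add: ennreal_leI)
        then show ?case
          using elim cap_bounds(1)[OF st(1)] order_trans[of _ "Time (ennreal s)" "\<sigma> \<omega>"] after[of \<omega>]
          by (auto simp: stopped_eq[OF st(1)] not_le less_imp_le split: split_indicator)
      qed
      show "AE \<omega> in P. (\<lambda>n. stopped (\<tau> n) s \<omega> * indicator A' \<omega>) \<longlonglongrightarrow> stopped \<sigma> s \<omega> * indicator A' \<omega>"
        using lim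
      proof eventually_elim
        case (elim \<omega>)
        show ?case
        proof (cases "\<omega> \<in> A'")
          case True
          then have "stopped \<sigma> s \<omega> = \<omega> s"
            using after[of \<omega>] by (simp add: stopped_eq[OF st(1)] cap_eq[OF st(1)])
          then show ?thesis using elim st True by simp
        qed simp
      qed
      show "(\<integral>\<^sup>+\<omega>. K \<partial>P) < \<infinity>" using K by (simp add: emeasure_space_1)
    qed (intro borel_measurable_const borel_measurable_times_ennreal borel_measurable_indicator A'P measP \<sigma> \<tau>(1) st)+
    have late: "(\<integral>\<^sup>+\<omega>\<in>A'. stopped \<sigma> t \<omega> \<partial>P) = (\<integral>\<^sup>+\<omega>\<in>A'. stopped \<sigma> s \<omega> \<partial>P)"
      using LIMSEQ_unique[OF L] R eq by simp
    have early: "stopped \<sigma> t \<omega> = stopped \<sigma> s \<omega>" if "\<sigma> \<omega> \<le> Time (ennreal s)" for \<omega>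
    proof -
      obtain v where v: "\<sigma> \<omega> = Time v" "v \<le> ennreal s" using \<open>\<sigma> \<omega> \<le> _\<close> by (cases "\<sigma> \<omega>") auto
      then obtain u where "0 \<le> u" "v = ennreal u" by (cases v) (auto simp: top_unique)
      then show ?thesis using v st by (simp add: stopped_eq cap_Time_ennreal min_absorb2 del: cap.simps)
    qed
    have split: "(\<integral>\<^sup>+\<omega>\<in>A. stopped \<sigma> r \<omega> \<partial>P) = (\<integral>\<^sup>+\<omega>\<in>A'. stopped \<sigma> r \<omega> \<partial>P) + (\<integral>\<^sup>+\<omega>\<in>A \<inter> ?S. stopped \<sigma> r \<omega> \<partial>P)"
      if "0 \<le> r" for r
    proof -
      have "(\<integral>\<^sup>+\<omega>\<in>A. stopped \<sigma> r \<omega> \<partial>P) =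
          (\<integral>\<^sup>+\<omega>. stopped \<sigma> r \<omega> * indicator A' \<omega> + stopped \<sigma> r \<omega> * indicator (A \<inter> ?S) \<omega> \<partial>P)"
        by (intro nn_integral_cong) (auto simp: A'_def split: split_indicator)
      then show ?thesis
        using measP[OF \<sigma> that] A'P AS by (subst (asm) nn_integral_add) auto
    qed
    show "(\<integral>\<^sup>+\<omega>\<in>A. stopped \<sigma> t \<omega> \<partial>P) = (\<integral>\<^sup>+\<omega>\<in>A. stopped \<sigma> s \<omega> \<partial>P)"
      unfolding split[OF t] split[OF st(1)] late
      by (intro arg_cong2[where f = "(+)"] refl nn_integral_cong) (auto simp: early split: split_indicator)
  qed (rule meas)
  have "\<forall>\<^sub>F K' in at_top. (SUP t\<in>{0..}. \<integral>\<^sup>+ \<omega>. stopped \<sigma> t \<omega> * indicator {\<omega>. ennreal K' < stopped \<sigma> t \<omega>} \<omega> \<partial>P) = 0"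
    using eventually_ge_at_top[of "enn2real K"]
  proof eventually_elim
    case (elim K')
    have "K \<le> ennreal K'"
      using elim K by (cases K) (auto simp: ennreal_leI)
    have "(\<integral>\<^sup>+ \<omega>. stopped \<sigma> t \<omega> * indicator {\<omega>. ennreal K' < stopped \<sigma> t \<omega>} \<omega> \<partial>P) = 0" if "0 \<le> t" for t
    proof -
      have "AE \<omega> in P. stopped \<sigma> t \<omega> * indicator {\<omega>. ennreal K' < stopped \<sigma> t \<omega>} \<omega> = 0"
        using le[OF that] by eventually_elim (use \<open>K \<le> _\<close> in \<open>auto split: split_indicator\<close>)
      then show ?thesis by (subst nn_integral_cong_AE) auto
    qed
    then show ?case by (simp add: SUP_eq_const)
  qed
  then show "is_uniformly_integrable P (stopped \<sigma>)"
    unfolding is_uniformly_integrable_def by (rule tendsto_eventually)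
qed

end

section \<open>Paths at high and low levels\<close>

lemma C_abs_hits_between:
  assumes C: "\<omega> \<in> C_abs" and u: "0 \<le> u" "\<omega> u \<noteq> \<infinity>"
    and c: "\<omega> 0 \<le> c \<and> c \<le> \<omega> u \<or> \<omega> u \<le> c \<and> c \<le> \<omega> 0"
  obtains v where "0 \<le> v" "v \<le> u" "\<omega> v = c"
  using C_abs_IVT[OF C u(2), of 0 u c] u(1) c by auto

lemma C_abs_bounded_before:
  assumes C: "\<omega> \<in> C_abs" and u: "0 \<le> u" "\<omega> u \<noteq> \<infinity>"
  obtains N :: nat where "\<And>v. 0 \<le> v \<Longrightarrow> v \<le> u \<Longrightarrow> \<omega> v < of_nat N"
proof -
  obtain w where w: "w \<in> {0..u}" "\<And>v. v \<in> {0..u} \<Longrightarrow> \<omega> v \<le> \<omega> w"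
    using continuous_attains_sup[OF compact_Icc _ C_abs_continuous_on_Icc[OF C u(2)]] u(1) by auto
  have "\<omega> w \<noteq> \<infinity>"
    using C_abs_inf_absorbing[OF C, of w u] w(1) u(2) by auto
  then obtain N where "\<omega> w < of_nat N"
    using ennreal_Ex_less_of_nat[of "\<omega> w"] by (auto simp: less_top)
  then show ?thesis
    using that[of N] w(2) by (meson atLeastAtMost_iff order.strict_trans1)
qed

lemma path_at_inf_of_finite_inf:
  assumes C: "\<omega> \<in> C_abs" and t: "0 \<le> t" "\<omega> t = \<infinity>"
  shows "path_at_inf \<omega> = \<infinity>"
proof (rule path_at_inf_tendsto[OF tendsto_eventually])
  show "\<forall>\<^sub>F s in at_top. \<omega> s = \<infinity>"
    unfolding eventually_at_top_linorder using C_abs_inf_absorbing[OF C t(1) _ t(2)] by blast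
qed

lemma ennreal_sqrt_eq_0_iff: "ennreal_sqrt x = 0 \<longleftrightarrow> x = 0"
  by (cases x) (auto simp: ennreal_sqrt_def ennreal_eq_0_iff)

lemma path_at_inf_eq_0_imp_Liminf:
  assumes "path_at_inf \<omega> = 0"
  shows "Liminf at_top \<omega> = 0"
proof -
  have "Liminf at_top \<omega> \<le> Limsup at_top \<omega>" by (rule Liminf_le_Limsup) simp
  moreover have "Limsup at_top \<omega> * Liminf at_top \<omega> = 0"
    using assms by (auto simp: path_at_inf_def Let_def ennreal_sqrt_eq_0_iff split: if_splits)
  ultimately show ?thesis by auto
qed

text \<open>
If \<open>liminf X\<^sub>t = 0\<close>, then \<open>X\<close> gets below \<open>c\<close> at a finite time and has crossed \<open>c\<close> by then.
\<close>

lemma hits_small_levels: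
  assumes C: "\<omega> \<in> C_abs" and fin: "\<And>t. 0 \<le> t \<Longrightarrow> \<omega> t \<noteq> \<infinity>"
    and liminf: "Liminf at_top \<omega> = 0" and c: "0 < c" "c \<le> \<omega> 0"
  obtains u where "0 \<le> u" "\<omega> u = c"
proof -
  have "\<not> (\<forall>\<^sub>F t in at_top. c \<le> \<omega> t)"
    using Liminf_bounded[of c \<omega> at_top] liminf c by auto
  then have "\<exists>t\<ge>0. \<not> c \<le> \<omega> t"
    unfolding eventually_at_top_linorder by blast
  then obtain t where t: "0 \<le> t" "\<omega> t \<le> c"
    by (auto simp: not_le intro: less_imp_le)
  show ?thesis
    by (rule C_abs_hits_between[OF C t(1) fin[OF t(1)], of c]) (use c t that in auto)
qed

text \<open>
A path without infinite values that is bounded by some \<open>N\<close> can reach the levels above \<open>N\<close> only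
through \<open>X\<^sub>\<infinity>\<close>, hence at most one of them. So \<open>limsup X\<^sub>t = \<infinity>\<close>, and then \<open>X\<^sub>\<infinity> = \<infinity>\<close> unless \<open>liminf X\<^sub>t = 0\<close>.
\<close>

lemma unbounded_path_at_inf:
  assumes C: "\<omega> \<in> C_abs" and large: "\<And>k::nat. hitting_time (of_nat (k + 2)) \<omega> < Beyond"
    and fin: "path_at_inf \<omega> \<noteq> \<infinity>"
  shows "Limsup at_top \<omega> = \<infinity>" "Liminf at_top \<omega> = 0" "\<And>t. 0 \<le> t \<Longrightarrow> \<omega> t \<noteq> \<infinity>"
proof -
  show no_inf: "\<And>t. 0 \<le> t \<Longrightarrow> \<omega> t \<noteq> \<infinity>"
    using path_at_inf_of_finite_inf[OF C] fin by blast
  show S: "Limsup at_top \<omega> = \<infinity>"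
  proof (rule ccontr)
    assume "Limsup at_top \<omega> \<noteq> \<infinity>"
    then obtain N1 where "Limsup at_top \<omega> < of_nat N1"
      using ennreal_Ex_less_of_nat[of "Limsup at_top \<omega>"] by (auto simp: less_top)
    then have "\<forall>\<^sub>F t in at_top. \<omega> t < of_nat N1" by (rule Limsup_lessD)
    then obtain r where r: "\<And>t. r \<le> t \<Longrightarrow> \<omega> t < of_nat N1"
      unfolding eventually_at_top_linorder by blast
    obtain N2 where N2: "\<And>v. 0 \<le> v \<Longrightarrow> v \<le> max 0 r \<Longrightarrow> \<omega> v < of_nat N2"
      using C_abs_bounded_before[OF C _ no_inf, of "max 0 r"] by auto
    define N where "N = max N1 N2"
    have N: "\<omega> t < of_nat N" if "0 \<le> t" for t
    proof (cases "r \<le> t")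
      case True
      then show ?thesis using r[OF True] unfolding N_def by (auto intro: order.strict_trans2)
    next
      case False
      then show ?thesis using N2[of t] that unfolding N_def by (auto intro: order.strict_trans2)
    qed
    have "path_at_inf \<omega> = of_nat (k + 2)" if "N \<le> k" for k
    proof -
      have "of_nat N \<le> (of_nat (k + 2) :: ennreal)" using that by (intro of_nat_mono) simp
      then have "\<not> (\<exists>s\<ge>0. \<omega> s = of_nat (k + 2))" using N by (metis not_le)
      then show ?thesis using large[of k] by (auto simp: hitting_time_less_Beyond_iff)
    qed
    from this[of N] this[of "Suc N"] have "of_nat (N + 2) = (of_nat (Suc N + 2) :: ennreal)" by simp
    then show False by (simp only: of_nat_eq_iff)
  qed
  show "Liminf at_top \<omega> = 0"
  proof (rule ccontr)
    assume "Liminf at_top \<omega> \<noteq> 0"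
    then have "path_at_inf \<omega> = \<infinity>"
      using S by (simp add: path_at_inf_def ennreal_sqrt_def ennreal_top_mult)
    then show False using fin by simp
  qed
qed

text \<open>
The second alternative accounts for the case in which both hitting times are \<^term>\<open>Beyond\<close>.
\<close>

lemma hitting_time_le_hitting_time_inf_iff:
  assumes C: "\<omega> \<in> C_abs" and c: "c \<noteq> \<infinity>"
  shows "hitting_time c \<omega> \<le> hitting_time \<infinity> \<omega> \<longleftrightarrow> hitting_time c \<omega> < Beyond \<or> path_at_inf \<omega> \<noteq> \<infinity>"
proof
  assume le: "hitting_time c \<omega> \<le> hitting_time \<infinity> \<omega>"
  show "hitting_time c \<omega> < Beyond \<or> path_at_inf \<omega> \<noteq> \<infinity>"
  proof (cases "hitting_time c \<omega> < Beyond")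
    case False
    then have "hitting_time \<infinity> \<omega> = Beyond"
      using le by (cases "hitting_time c \<omega>"; cases "hitting_time \<infinity> \<omega>") auto
    then show ?thesis
      using hitting_time_less_Beyond_iff[of \<infinity> \<omega>] by auto
  qed simp
next
  assume or: "hitting_time c \<omega> < Beyond \<or> path_at_inf \<omega> \<noteq> \<infinity>"
  show "hitting_time c \<omega> \<le> hitting_time \<infinity> \<omega>"
  proof (rule ccontr)
    assume "\<not> hitting_time c \<omega> \<le> hitting_time \<infinity> \<omega>"
    then have less: "hitting_time \<infinity> \<omega> < hitting_time c \<omega>" by simp
    then have "hitting_time \<infinity> \<omega> < Beyond"
      by (cases "hitting_time \<infinity> \<omega>") auto
    then have inf: "path_at_inf \<omega> = \<infinity>"
      using hitting_time_less_Beyond_iff[of \<infinity> \<omega>] path_at_inf_of_finite_inf[OF C] by blast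
    then have "hitting_time c \<omega> < Beyond" using or by simp
    then obtain u where u: "0 \<le> u" "\<omega> u = c"
      using hitting_time_less_Beyond_iff[of c \<omega>] inf c by auto
    then have "hitting_time c \<omega> \<le> Time (ennreal u)"
      using hitting_time_le_iff[OF C u(1), of c] by auto
    then have "hitting_time \<infinity> \<omega> \<le> Time (ennreal u)" using less by (metis less_le_not_le order_trans)
    then show False using hitting_time_inf_le_iff[OF C u(1)] u c by simp
  qed
qed

text \<open>
Only finite times count here, in contrast to \<^term>\<open>hitting_time c \<omega> < hitting_time d \<omega>\<close>, which also
holds if \<open>X\<^sub>\<infinity> = c\<close> and the level \<open>d\<close> is never reached.
\<close>

definition hits_before :: "ennreal \<Rightarrow> ennreal \<Rightarrow> path set" where
  "hits_before c d = {\<omega> \<in> C_abs. \<exists>u\<ge>0. \<omega> u = c \<and> (\<forall>v. 0 \<le> v \<longrightarrow> v \<le> u \<longrightarrow> \<omega> v \<noteq> d)}"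

text \<open>
If \<open>c\<close> is hit first, then by right-continuity there is a rational time, or \<open>t\<close> itself, at which \<open>c\<close>
has been hit and \<open>d\<close> has not.
\<close>

lemma hits_before_until:
  assumes C: "\<omega> \<in> C_abs" and t: "0 \<le> t"
  shows "\<omega> \<in> hits_before c d \<and> min (hitting_time c \<omega>) (hitting_time d \<omega>) \<le> Time (ennreal t) \<longleftrightarrow>
    (\<exists>q\<in>rational_times t. hitting_time c \<omega> \<le> Time (ennreal q) \<and> \<not> hitting_time d \<omega> \<le> Time (ennreal q))"
proof
  assume *: "\<omega> \<in> hits_before c d \<and> min (hitting_time c \<omega>) (hitting_time d \<omega>) \<le> Time (ennreal t)"
  then obtain u where u: "0 \<le> u" "\<omega> u = c" "\<And>v. 0 \<le> v \<Longrightarrow> v \<le> u \<Longrightarrow> \<omega> v \<noteq> d"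
    by (auto simp: hits_before_def)
  obtain w where w: "0 \<le> w" "w \<le> t" "\<omega> w = c \<or> \<omega> w = d"
    using * hitting_time_le_iff[OF C t] by (auto simp: min_le_iff_disj)
  obtain u' where u': "0 \<le> u'" "u' \<le> t" "u' \<le> u" "\<omega> u' = c"
  proof (cases "u \<le> t")
    case True
    then show ?thesis using that u by auto
  next
    case False
    then show ?thesis using that[of w] w u(3)[of w] by auto
  qed
  then obtain q where q: "q \<in> rational_times t" "u' \<le> q" "\<And>v. u' \<le> v \<Longrightarrow> v \<le> q \<Longrightarrow> \<omega> v \<in> - {d}"
    using C_abs_rational_time_nearby[OF C u'(1,2), of "- {d}"] u(3)[of u'] by auto
  have "\<omega> v \<noteq> d" if "0 \<le> v" "v \<le> q" for v
    using that q(3)[of v] u(3)[of v] u'(3) by (cases "u' \<le> v") auto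
  moreover have q0: "0 \<le> q" using q u' by simp
  ultimately show "\<exists>q\<in>rational_times t. hitting_time c \<omega> \<le> Time (ennreal q) \<and> \<not> hitting_time d \<omega> \<le> Time (ennreal q)"
    using q u' hitting_time_le_iff[OF C q0] by blast
next
  assume "\<exists>q\<in>rational_times t. hitting_time c \<omega> \<le> Time (ennreal q) \<and> \<not> hitting_time d \<omega> \<le> Time (ennreal q)"
  then obtain q where q: "q \<in> rational_times t" and
    hit: "hitting_time c \<omega> \<le> Time (ennreal q)" "\<not> hitting_time d \<omega> \<le> Time (ennreal q)" by blast
  note qt = rational_times_bounds[OF t q]
  obtain u where u: "0 \<le> u" "u \<le> q" "\<omega> u = c"
    using hit(1) qt hitting_time_le_iff[OF C, of q c] by auto
  have "\<omega> v \<noteq> d" if "0 \<le> v" "v \<le> u" for v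
    using hit(2) qt hitting_time_le_iff[OF C, of q d] u that by auto
  then have "\<omega> \<in> hits_before c d"
    using C u by (auto simp: hits_before_def)
  moreover have "hitting_time c \<omega> \<le> Time (ennreal t)"
    using hit(1) qt by (meson ennreal_leI order_trans xtime_le_simps(1))
  ultimately show "\<omega> \<in> hits_before c d \<and> min (hitting_time c \<omega>) (hitting_time d \<omega>) \<le> Time (ennreal t)"
    by (simp add: min_le_iff_disj)
qed

lemma hits_before_Filt_at:
  assumes c: "c \<noteq> \<infinity>" and d: "d \<noteq> \<infinity>" and A: "A \<in> sets (Filt_at (hitting_time c))"
  shows "A \<inter> hits_before c d \<in> sets (Filt_at (\<lambda>\<omega>. min (hitting_time c \<omega>) (hitting_time d \<omega>)))"
proof -
  let ?\<sigma> = "\<lambda>\<omega>. min (hitting_time c \<omega>) (hitting_time d \<omega>)"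
  note st = stopping_time_hitting_time[OF c] stopping_time_hitting_time[OF d]
  note A' = A[unfolded sets_Filt_at_iff[OF st(1)]]
  have A_sub: "A \<subseteq> C_abs" using sets.sets_into_space[OF A] by simp
  have part: "A \<inter> hits_before c d \<inter> {\<omega> \<in> C_abs. ?\<sigma> \<omega> \<le> Time (ennreal t)} \<in> sets (Filt t)" if t: "0 \<le> t" for t
  proof -
    have "A \<inter> hits_before c d \<inter> {\<omega> \<in> C_abs. ?\<sigma> \<omega> \<le> Time (ennreal t)} =
        (\<Union>q\<in>rational_times t. (A \<inter> {\<omega> \<in> C_abs. hitting_time c \<omega> \<le> Time (ennreal q)}) -
          {\<omega> \<in> C_abs. hitting_time d \<omega> \<le> Time (ennreal q)})"
      using hits_before_until[OF _ t, of _ c d] A_sub by blast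
    also have "\<dots> \<in> sets (Filt t)"
    proof (rule sets.countable_UN'[OF countable_rational_times], rule image_subsetI)
      fix q assume q: "q \<in> rational_times t"
      note qt = rational_times_bounds[OF t q]
      have "A \<inter> {\<omega> \<in> C_abs. hitting_time c \<omega> \<le> Time (ennreal q)} \<in> sets (Filt q)"
        "{\<omega> \<in> C_abs. hitting_time d \<omega> \<le> Time (ennreal q)} \<in> sets (Filt q)"
        using A' st(2) qt unfolding is_stopping_time_def by blast+
      then show "A \<inter> {\<omega> \<in> C_abs. hitting_time c \<omega> \<le> Time (ennreal q)} -
          {\<omega> \<in> C_abs. hitting_time d \<omega> \<le> Time (ennreal q)} \<in> sets (Filt t)"
        using sets_Filt_mono[of q t] qt by blast
    qed
    finally show ?thesis .
  qed
  have "A \<inter> hits_before c d = (\<Union>n. A \<inter> hits_before c d \<inter> {\<omega> \<in> C_abs. ?\<sigma> \<omega> \<le> Time (ennreal (real n))})"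
  proof -
    have "\<exists>n. ?\<sigma> \<omega> \<le> Time (ennreal (real n))" if hb: "\<omega> \<in> hits_before c d" for \<omega>
    proof -
      obtain u where u: "0 \<le> u" "\<omega> u = c" "\<omega> \<in> C_abs" using hb by (auto simp: hits_before_def)
      have le: "u \<le> real (nat \<lceil>u\<rceil>)" by linarith
      then have "hitting_time c \<omega> \<le> Time (ennreal (real (nat \<lceil>u\<rceil>)))"
        using hitting_time_le_iff[OF u(3), of "real (nat \<lceil>u\<rceil>)" c] u by auto
      then show ?thesis by (auto simp: min_le_iff_disj)
    qed
    then show ?thesis using A_sub by blast
  qed
  also have "\<dots> \<in> sets Filt_inf"
    using part sets_Filt_subset
    by (intro sets.countable_UN) (meson image_subset_iff of_nat_0_le_iff subsetD)
  finally show ?thesis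
    unfolding sets_Filt_at_iff[OF stopping_time_min[OF st]] using part by blast
qed

lemma X_at_hits_before:
  assumes "\<omega> \<in> hits_before c d"
  shows "X_at (\<lambda>\<omega>. min (hitting_time c \<omega>) (hitting_time d \<omega>)) \<omega> = c"
proof -
  obtain u where u: "0 \<le> u" "\<omega> u = c" "\<And>v. 0 \<le> v \<Longrightarrow> v \<le> u \<Longrightarrow> \<omega> v \<noteq> d" and C: "\<omega> \<in> C_abs"
    using assms by (auto simp: hits_before_def)
  have "hitting_time c \<omega> \<le> Time (ennreal u)" using hitting_time_le_iff[OF C u(1)] u by auto
  then obtain v where v: "hitting_time c \<omega> = Time v" "v \<le> ennreal u"
    by (cases "hitting_time c \<omega>") auto
  then obtain w where w: "0 \<le> w" "v = ennreal w" by (cases v) (auto simp: top_unique)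
  then have wu: "w \<le> u" using v u by simp
  have wc: "\<omega> w = c" using C_abs_first_hit[OF C w(1)] v w by simp
  have "\<not> hitting_time d \<omega> \<le> Time (ennreal w)"
    using hitting_time_le_iff[OF C w(1)] u(3) wu by (meson order_trans)
  then have "min (hitting_time c \<omega>) (hitting_time d \<omega>) = Time (ennreal w)"
    using v w by (simp add: min_absorb1)
  then show ?thesis using X_at_finite[of _ \<omega> w] w(1) wc by simp
qed

lemma hits_before_mono:
  assumes 1: "\<omega> 0 \<le> d" "d \<le> d'" "d' \<noteq> \<infinity>" and hb: "\<omega> \<in> hits_before c d"
  shows "\<omega> \<in> hits_before c d'"
proof -
  obtain u where u: "0 \<le> u" "\<omega> u = c" "\<And>v. 0 \<le> v \<Longrightarrow> v \<le> u \<Longrightarrow> \<omega> v \<noteq> d" and C: "\<omega> \<in> C_abs"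
    using hb by (auto simp: hits_before_def)
  have "\<omega> v \<noteq> d'" if v: "0 \<le> v" "v \<le> u" for v
  proof
    assume eq: "\<omega> v = d'"
    then obtain w where "0 \<le> w" "w \<le> v" "\<omega> w = d"
      using C_abs_hits_between[OF C v(1), of d] 1 by auto
    then show False using u(3)[of w] v by auto
  qed
  then show ?thesis using u C by (auto simp: hits_before_def)
qed

lemma hits_before_large_level:
  assumes C: "\<omega> \<in> C_abs" and u: "0 \<le> u" "\<omega> u = c" and c: "c \<noteq> \<infinity>"
  obtains k :: nat where "\<omega> \<in> hits_before c (of_nat (k + 2))"
proof -
  obtain N where N: "\<And>v. 0 \<le> v \<Longrightarrow> v \<le> u \<Longrightarrow> \<omega> v < of_nat N"
    using C_abs_bounded_before[OF C u(1)] u c by auto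
  have "of_nat N \<le> (of_nat (N + 2) :: ennreal)" by (intro of_nat_mono) simp
  then have "\<omega> v \<noteq> of_nat (N + 2)" if "0 \<le> v" "v \<le> u" for v
    using N[OF that] by (metis not_le)
  then show ?thesis using that[of N] u C by (auto simp: hits_before_def)
qed

lemma bounded_before_hitting:
  assumes C: "\<omega> \<in> C_abs" and fin: "\<And>t. 0 \<le> t \<Longrightarrow> \<omega> t \<noteq> \<infinity>" and d: "\<omega> 0 \<le> d"
    and v: "0 \<le> v" "Time (ennreal v) \<le> hitting_time d \<omega>"
  shows "\<omega> v \<le> d"
proof (rule ccontr)
  assume *: "\<not> \<omega> v \<le> d"
  obtain w where w: "0 \<le> w" "w \<le> v" "\<omega> w = d"
    by (rule C_abs_hits_between[OF C v(1) fin[OF v(1)], of d]) (use * d in auto)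
  then have "w < v" using * by (metis less_eq_real_def order.refl)
  have "hitting_time d \<omega> \<le> Time (ennreal w)"
    using hitting_time_le_iff[OF C w(1)] w by auto
  with v(2) have "Time (ennreal v) \<le> Time (ennreal w)" by (rule order_trans)
  then show False using \<open>w < v\<close> w(1) by simp
qed

lemma hitting_before_Beyond_measurable:
  assumes c: "c \<noteq> \<infinity>"
  shows "{\<omega> \<in> C_abs. hitting_time c \<omega> < Beyond} \<in> sets Filt_inf"
proof -
  let ?S = "\<lambda>n. {\<omega> \<in> C_abs. hitting_time c \<omega> \<le> Time (ennreal (real n))}"
  have "{\<omega> \<in> C_abs. hitting_time c \<omega> < Beyond} =
      (\<Union>n. ?S n) \<union> {\<omega> \<in> space Filt_inf. path_at_inf \<omega> \<in> {c}}"
  proof -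
    have "(\<exists>s\<ge>0. \<omega> s = c) \<longleftrightarrow> (\<exists>n. \<omega> \<in> ?S n)" if C: "\<omega> \<in> C_abs" for \<omega>
    proof
      assume "\<exists>s\<ge>0. \<omega> s = c"
      then obtain s where s: "0 \<le> s" "\<omega> s = c" by blast
      have "s \<le> real (nat \<lceil>s\<rceil>)" by linarith
      then have "\<omega> \<in> ?S (nat \<lceil>s\<rceil>)"
        using hitting_time_le_iff[OF C, of "real (nat \<lceil>s\<rceil>)" c] s C by auto
      then show "\<exists>n. \<omega> \<in> ?S n" ..
    qed (use hitting_time_le_iff[OF C, of "real _" c] in auto)
    then show ?thesis by (auto simp: hitting_time_less_Beyond_iff)
  qed
  also have "\<dots> \<in> sets Filt_inf"
  proof (intro sets.Un sets.countable_UN level_sets_measurable path_at_inf_measurable)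
    show "range ?S \<subseteq> sets Filt_inf"
      using stopping_time_hitting_time[OF c] sets_Filt_subset[of "real _"]
      unfolding is_stopping_time_def by (meson image_subset_iff of_nat_0_le_iff subsetD)
  qed simp
  finally show ?thesis .
qed

section \<open>The Foellmer measure as a change of measure\<close>

lemma sets_Filt_at_subset: "is_stopping_time \<tau> \<Longrightarrow> sets (Filt_at \<tau>) \<subseteq> sets Filt_inf"
  by (auto simp: sets_Filt_at_iff)

context path_prob_space
begin

lemma subalgebra_Filt_at: "is_stopping_time \<tau> \<Longrightarrow> subalgebra P (Filt_at \<tau>)"
  using sets_Filt_at_subset by (simp add: subalgebra_def space_P sets_P)

text \<open>
Integrability makes the stopped processes almost surely finite at all integer times, and
absorption in \<open>\<infinity>\<close> carries this over to all times.
\<close>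

lemma AE_finite_path:
  assumes X: "X_is_local_martingale P"
  shows "AE \<omega> in P. \<forall>t\<ge>0. \<omega> t \<noteq> \<infinity>"
proof -
  obtain \<tau> where \<tau>: "\<And>n. is_stopping_time (\<tau> n)"
      "AE \<omega> in P. \<forall>t\<ge>0. \<forall>\<^sub>F n in sequentially. Time (ennreal t) < \<tau> n \<omega>"
      "\<And>n. is_martingale P (stopped (\<tau> n))"
    using X unfolding X_is_local_martingale_def by blast
  have "AE \<omega> in P. stopped (\<tau> n) (real m) \<omega> \<noteq> \<infinity>" for n m :: nat
  proof (rule nn_integral_PInf_AE)
    have "stopped (\<tau> n) (real m) \<in> borel_measurable (Filt (real m))" "(\<integral>\<^sup>+\<omega>. stopped (\<tau> n) (real m) \<omega> \<partial>P) < \<infinity>"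
      using \<tau>(3)[of n] by (simp_all add: is_martingale_def)
    then show "stopped (\<tau> n) (real m) \<in> borel_measurable P" "(\<integral>\<^sup>+\<omega>. stopped (\<tau> n) (real m) \<omega> \<partial>P) \<noteq> \<infinity>"
      using Filt_measurable[of "real m"] by auto
  qed
  then have "AE \<omega> in P. \<forall>n m. stopped (\<tau> n) (real m) \<omega> \<noteq> \<infinity>"
    by (simp add: AE_all_countable)
  with \<tau>(2) AE_space show ?thesis
  proof eventually_elim
    case (elim \<omega>)
    show ?case
    proof (intro allI impI)
      fix t :: real assume t: "0 \<le> t"
      define m where "m = nat \<lceil>t\<rceil>"
      have m: "t \<le> real m" unfolding m_def by linarith
      have "\<forall>\<^sub>F n in sequentially. Time (ennreal (real m)) < \<tau> n \<omega>"
        using elim(1) by simp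
      then obtain n where n: "Time (ennreal (real m)) < \<tau> n \<omega>"
        by (auto simp: eventually_sequentially)
      have "stopped (\<tau> n) (real m) \<omega> = \<omega> (real m)"
        using n by (simp add: stopped_eq cap_eq)
      then have "\<omega> (real m) \<noteq> \<infinity>" using elim(3) by metis
      then show "\<omega> t \<noteq> \<infinity>"
        using C_abs_inf_absorbing[of \<omega> t "real m"] elim(2) t m by (auto simp: space_P)
    qed
  qed
qed

end

text \<open>
The assumption \<open>vanishing_P\<close> is \<open>b = 0\<close>, in terms of \<open>X\<^sub>\<infinity>\<close>.
\<close>

locale Foellmer_pair = path_prob_space P for P +
  fixes Q :: "path measure"
  assumes local_martingale: "X_is_local_martingale P"
    and start_P: "AE \<omega> in P. \<omega> 0 = 1"
    and vanishing_P: "AE \<omega> in P. path_at_inf \<omega> = 0"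
    and Foellmer: "is_Foellmer_measure P Q"
begin

sublocale Q: path_prob_space Q
  using Foellmer by (auto simp: is_Foellmer_measure_def path_prob_space_def path_prob_space_axioms_def)

lemma emeasure_Q:
  assumes \<sigma>: "is_stopping_time \<sigma>" and K: "K < \<infinity>"
    and bound: "AE \<omega> in P. \<forall>v\<ge>0. Time (ennreal v) \<le> \<sigma> \<omega> \<longrightarrow> \<omega> v \<le> K"
    and A: "A \<in> sets (Filt_at \<sigma>)"
  shows "emeasure Q A = (\<integral>\<^sup>+\<omega>\<in>A. X_at \<sigma> \<omega> \<partial>P)"
proof -
  have eq: "restr_to_subalg Q (Filt_at \<sigma>) = density (restr_to_subalg P (Filt_at \<sigma>)) (X_at \<sigma>)"
    using Foellmer \<sigma> bounded_stopped_martingale[OF local_martingale \<sigma> K bound]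
    unfolding is_Foellmer_measure_def by blast
  note sub = subalgebra_Filt_at[OF \<sigma>]
  note meas = X_at_measurable[OF \<sigma>]
  have "emeasure Q A = emeasure (restr_to_subalg Q (Filt_at \<sigma>)) A"
    by (rule emeasure_restr_to_subalg[OF Q.subalgebra_Filt_at[OF \<sigma>] A, symmetric])
  also have "\<dots> = (\<integral>\<^sup>+\<omega>\<in>A. X_at \<sigma> \<omega> \<partial>restr_to_subalg P (Filt_at \<sigma>))"
    unfolding eq using A measurable_in_subalg[OF sub meas] sets_restr_to_subalg[OF sub]
    by (intro emeasure_density) simp_all
  also have "\<dots> = (\<integral>\<^sup>+\<omega>\<in>A. X_at \<sigma> \<omega> \<partial>P)"
    using A meas by (intro nn_integral_subalgebra2[OF sub]) simp
  finally show ?thesis .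
qed

lemma AE_good: "AE \<omega> in P. \<omega> \<in> C_abs \<and> \<omega> 0 = 1 \<and> path_at_inf \<omega> = 0 \<and> (\<forall>t\<ge>0. \<omega> t \<noteq> \<infinity>)"
  using AE_space start_P vanishing_P AE_finite_path[OF local_martingale]
  by eventually_elim (simp add: space_P)

lemma bounded_until_hitting:
  assumes d: "1 \<le> d"
    and le: "\<And>\<omega>. \<sigma> \<omega> \<le> hitting_time d \<omega>"
  shows "AE \<omega> in P. \<forall>v\<ge>0. Time (ennreal v) \<le> \<sigma> \<omega> \<longrightarrow> \<omega> v \<le> d"
  using AE_good
proof eventually_elim
  case (elim \<omega>)
  show ?case
  proof (intro allI impI)
    fix v :: real assume v: "0 \<le> v" "Time (ennreal v) \<le> \<sigma> \<omega>"
    from v(2) le have "Time (ennreal v) \<le> hitting_time d \<omega>" by (rule order_trans)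
    then show "\<omega> v \<le> d"
      by (rule bounded_before_hitting[rotated 4]) (use elim d v in simp_all)
  qed
qed

lemma Q_start: "AE \<omega> in Q. \<omega> 0 = 1"
proof -
  let ?T = "hitting_time 2" and ?A = "{\<omega> \<in> space (Filt 0). \<omega> 0 \<in> - {1}}"
  have st: "is_stopping_time ?T" by (rule stopping_time_hitting_time) simp
  have A: "?A \<in> sets (Filt 0)"
    by (intro level_sets_measurable eval_measurable_Filt) auto
  have "emeasure Q ?A = (\<integral>\<^sup>+\<omega>\<in>?A. X_at ?T \<omega> \<partial>P)"
    by (rule emeasure_Q[OF st _ bounded_until_hitting Filt_0_in_Filt_at[OF st A], where K = 2]) auto
  also have "\<dots> = (\<integral>\<^sup>+\<omega>. 0 \<partial>P)"
    by (intro nn_integral_cong_AE) (use start_P in \<open>eventually_elim, auto split: split_indicator\<close>)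
  finally show ?thesis
    using A Q.Filt_sets[of 0 ?A] by (intro AE_I'[of ?A]) (auto simp: null_sets_def Q.space_P)
qed

text \<open>
\<open>X\<close> stopped at \<open>T\<^sub>d\<close> is bounded by \<open>d\<close>, so that \<open>dQ = X\<^bsub>T\<^sub>d\<^esub> dP\<close> on the events up to \<open>T\<^sub>d\<close>. Where \<open>d\<close> is not hit,
the density is \<open>X\<^sub>\<infinity> = 0\<close>.
\<close>

lemma Q_hits_level:
  assumes d: "1 \<le> d" "d \<noteq> \<infinity>"
  shows "AE \<omega> in Q. hitting_time d \<omega> < Beyond"
proof -
  let ?T = "hitting_time d" and ?A = "C_abs - {\<omega> \<in> C_abs. hitting_time d \<omega> < Beyond}"
  have st: "is_stopping_time ?T" by (rule stopping_time_hitting_time[OF d(2)])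
  have A_inf: "?A \<in> sets Filt_inf"
    using hitting_before_Beyond_measurable[OF d(2)] sets.compl_sets[of _ Filt_inf] by auto
  have "?A \<inter> {\<omega> \<in> C_abs. ?T \<omega> \<le> Time (ennreal t)} = {}" for t
    by (auto simp: less_Beyond_iff)
  then have A: "?A \<in> sets (Filt_at ?T)"
    unfolding sets_Filt_at_iff[OF st] using A_inf by simp
  have "emeasure Q ?A = (\<integral>\<^sup>+\<omega>\<in>?A. X_at ?T \<omega> \<partial>P)"
    by (rule emeasure_Q[OF st _ bounded_until_hitting A, where K = d]) (use d in \<open>auto simp: less_top\<close>)
  also have "\<dots> = (\<integral>\<^sup>+\<omega>. 0 \<partial>P)"
    by (intro nn_integral_cong_AE)
      (use vanishing_P in \<open>eventually_elim, auto simp: less_Beyond_iff X_at_infinite split: split_indicator\<close>)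
  finally show ?thesis
    using A_inf by (intro AE_I'[of ?A]) (auto simp: null_sets_def Q.space_P Q.sets_P)
qed

lemma Q_hits_all_levels:
  "AE \<omega> in Q. \<omega> \<in> C_abs \<and> \<omega> 0 = 1 \<and> (\<forall>k::nat. hitting_time (of_nat (k + 2)) \<omega> < Beyond)"
proof -
  have "AE \<omega> in Q. \<forall>k::nat. hitting_time (of_nat (k + 2)) \<omega> < Beyond"
    unfolding AE_all_countable
  proof
    fix k :: nat
    have "of_nat 1 \<le> (of_nat (k + 2) :: ennreal)" by (intro of_nat_mono) simp
    then show "AE \<omega> in Q. hitting_time (of_nat (k + 2)) \<omega> < Beyond"
      by (intro Q_hits_level) simp_all
  qed
  with Q_start AE_space show ?thesis
    by eventually_elim (simp add: Q.space_P)
qed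

text \<open>
Where \<open>c\<close> is hit before a level \<open>d \<ge> 1\<close>, the density of \<open>Q\<close> up to \<open>T\<^sub>c \<and> T\<^sub>d\<close> is the constant \<open>c\<close>. As \<open>d\<close>
increases, these events exhaust everything under \<open>P\<close>, since paths that are finite and have \<open>X\<^sub>\<infinity> = 0\<close>
hit \<open>c\<close> at a finite time and are bounded until then. Under \<open>Q\<close> they exhaust \<open>{T\<^sub>c < \<TT>}\<close>: a path that
hits \<open>c\<close> at a finite time does so before some large level, and a path that hits all large levels
cannot have \<open>X\<^sub>\<infinity> = c\<close>. In particular \<open>Q(T\<^sub>c < \<TT>) = c\<close>.
\<close>

lemma emeasure_Q_hitting:
  assumes c: "0 < c" "c < 1" and A: "A \<in> sets (Filt_at (hitting_time c))"
  shows "emeasure Q (A \<inter> {\<omega> \<in> C_abs. hitting_time c \<omega> < Beyond}) = c * emeasure P A"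
proof -
  have c_fin: "c \<noteq> \<infinity>" using c by auto
  let ?d = "\<lambda>k::nat. of_nat (k + 2) :: ennreal"
  let ?\<sigma> = "\<lambda>k \<omega>. min (hitting_time c \<omega>) (hitting_time (?d k) \<omega>)"
  define N where "N = {\<omega> \<in> space (Filt 0). \<omega> 0 \<in> {1}}"
  \<comment> \<open>Starting from \<open>1\<close>, a path crosses \<open>?d k\<close> before any higher level; this makes \<open>E\<close> increasing.\<close>
  define E where "E k = A \<inter> N \<inter> hits_before c (?d k)" for k
  have d: "1 \<le> ?d k" "?d k \<noteq> \<infinity>" "?d k < \<infinity>" for k
    using of_nat_mono[of 1 "k + 2", where 'a = ennreal] of_nat_less_top[of "k + 2"]
    by (simp_all del: of_nat_add)
  have st: "is_stopping_time (hitting_time c)" by (rule stopping_time_hitting_time[OF c_fin])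
  have st\<sigma>: "is_stopping_time (?\<sigma> k)" for k
    using st stopping_time_hitting_time[OF d(2)] by (rule stopping_time_min)
  have N0: "N \<in> sets (Filt 0)"
    unfolding N_def by (intro level_sets_measurable eval_measurable_Filt) auto
  have E\<sigma>: "E k \<in> sets (Filt_at (?\<sigma> k))" for k
    unfolding E_def using A Filt_0_in_Filt_at[OF st N0]
    by (intro hits_before_Filt_at c_fin d(2) sets.Int)
  have E: "E k \<in> sets Filt_inf" for k
    using sets_Filt_at_subset[OF st\<sigma>] E\<sigma> by blast
  have A_inf: "A \<in> sets Filt_inf" using A sets_Filt_at_subset[OF st] by blast
  have step: "emeasure Q (E k) = c * emeasure P (E k)" for k
  proof -
    have "emeasure Q (E k) = (\<integral>\<^sup>+\<omega>\<in>E k. X_at (?\<sigma> k) \<omega> \<partial>P)"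
      by (rule emeasure_Q[OF st\<sigma> d(3)[of k] bounded_until_hitting[OF d(1)[of k]] E\<sigma>])
        (rule min.cobounded2)
    also have "\<dots> = (\<integral>\<^sup>+\<omega>. c * indicator (E k) \<omega> \<partial>P)"
      by (intro nn_integral_cong) (auto simp: E_def X_at_hits_before split: split_indicator)
    finally show ?thesis using E by (simp add: nn_integral_cmult_indicator sets_P)
  qed
  have inc: "incseq E"
  proof (rule incseq_SucI)
    fix k
    have "?d k \<le> ?d (Suc k)" by (intro of_nat_mono) simp
    then show "E k \<subseteq> E (Suc k)"
      using hits_before_mono[OF _ _ d(2)[of "Suc k"], of _ "?d k" c] d(1)[of k]
      by (auto simp: E_def N_def)
  qed
  have "emeasure Q (\<Union>k. E k) = (SUP k. emeasure Q (E k))"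
    using E inc by (intro SUP_emeasure_incseq[symmetric]) (auto simp: Q.sets_P)
  also have "\<dots> = c * (SUP k. emeasure P (E k))"
    by (simp add: step SUP_mult_left_ennreal)
  also have "(SUP k. emeasure P (E k)) = emeasure P (\<Union>k. E k)"
    using E inc by (intro SUP_emeasure_incseq) (auto simp: sets_P)
  also have "\<dots> = emeasure P A"
  proof (rule emeasure_eq_AE)
    show "AE \<omega> in P. \<omega> \<in> (\<Union>k. E k) \<longleftrightarrow> \<omega> \<in> A"
      using AE_good
    proof eventually_elim
      case (elim \<omega>)
      then have C: "\<omega> \<in> C_abs" and N: "\<omega> \<in> N" by (auto simp: N_def)
      obtain u where u: "0 \<le> u" "\<omega> u = c"
        by (rule hits_small_levels[OF C _ path_at_inf_eq_0_imp_Liminf c(1)])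
          (use elim c in \<open>auto intro: less_imp_le\<close>)
      then obtain k where "\<omega> \<in> hits_before c (?d k)"
        using hits_before_large_level[OF C u c_fin] by blast
      then show ?case using N by (auto simp: E_def)
    qed
  qed (use E A_inf in \<open>auto simp: sets_P\<close>)
  also have "emeasure Q (\<Union>k. E k) = emeasure Q (A \<inter> {\<omega> \<in> C_abs. hitting_time c \<omega> < Beyond})"
  proof (rule emeasure_eq_AE)
    show "AE \<omega> in Q. \<omega> \<in> (\<Union>k. E k) \<longleftrightarrow> \<omega> \<in> A \<inter> {\<omega> \<in> C_abs. hitting_time c \<omega> < Beyond}"
      using Q_hits_all_levels
    proof eventually_elim
      case (elim \<omega>)
      then have C: "\<omega> \<in> C_abs" and N: "\<omega> \<in> N" by (auto simp: N_def)
      have "\<exists>k. \<omega> \<in> hits_before c (?d k)" if hit: "hitting_time c \<omega> < Beyond"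
      proof -
        have "path_at_inf \<omega> \<noteq> c"
        proof
          assume p: "path_at_inf \<omega> = c"
          then have "Limsup at_top \<omega> = \<infinity>" "Liminf at_top \<omega> = 0"
            using unbounded_path_at_inf[OF C] elim c_fin by blast+
          \<comment> \<open>Here the convention \<open>\<infinity> \<cdot> 0 = 1\<close> enters, and \<open>c < 1\<close> excludes this value.\<close>
          then have "path_at_inf \<omega> = 1"
            using ennreal_sqrt_square[of 1] by (simp add: path_at_inf_def)
          then show False using p c by simp
        qed
        then obtain u where "0 \<le> u" "\<omega> u = c"
          using hit by (auto simp: hitting_time_less_Beyond_iff)
        then show ?thesis using hits_before_large_level[OF C _ _ c_fin] by metis
      qed
      moreover have "hitting_time c \<omega> < Beyond" if "\<omega> \<in> hits_before c (?d k)" for k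
        using that by (auto simp: hits_before_def hitting_time_less_Beyond_iff)
      ultimately show ?case using N C by (auto simp: E_def)
    qed
  qed (use E A_inf hitting_before_Beyond_measurable[OF c_fin] in \<open>auto simp: Q.sets_P\<close>)
  finally show ?thesis .
qed

text \<open>
A path that hits all large levels without \<open>X\<^sub>\<infinity> = \<infinity>\<close> has \<open>liminf X\<^sub>t = 0\<close> and hits every level
\<open>c \<in> (0,1)\<close>. This has probability at most \<open>Q(T\<^sub>c < \<TT>) = c\<close>, for all \<open>c\<close>.
\<close>

lemma Q_path_at_inf: "AE \<omega> in Q. path_at_inf \<omega> = \<infinity>"
proof -
  let ?E = "{\<omega> \<in> space Filt_inf. path_at_inf \<omega> \<in> - {\<infinity>}}"
  have E: "?E \<in> sets Q"
    unfolding Q.sets_P by (intro level_sets_measurable path_at_inf_measurable) auto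
  have le: "emeasure Q ?E \<le> ennreal (inverse (real (Suc (Suc k))))" for k
  proof -
    let ?c = "ennreal (inverse (real (Suc (Suc k))))"
    have c: "0 < ?c" "?c < 1" by (auto simp: ennreal_less_one_iff inverse_less_1_iff)
    let ?H = "{\<omega> \<in> C_abs. hitting_time ?c \<omega> < Beyond}"
    have "emeasure Q ?E \<le> emeasure Q ?H"
    proof (rule emeasure_mono_AE)
      show "AE \<omega> in Q. \<omega> \<in> ?E \<longrightarrow> \<omega> \<in> ?H"
        using Q_hits_all_levels
      proof eventually_elim
        case (elim \<omega>)
        show ?case
        proof
          assume "\<omega> \<in> ?E"
          then have p: "path_at_inf \<omega> \<noteq> \<infinity>" by simp
          have C: "\<omega> \<in> C_abs" using elim by simp
          note u = unbounded_path_at_inf[OF C _ p]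
          obtain u where "0 \<le> u" "\<omega> u = ?c"
            by (rule hits_small_levels[OF C u(3) u(2) c(1)]) (use elim c in \<open>auto intro: less_imp_le\<close>)
          then show "\<omega> \<in> ?H" using C by (auto simp: hitting_time_less_Beyond_iff)
        qed
      qed
      show "?H \<in> sets Q" unfolding Q.sets_P by (rule hitting_before_Beyond_measurable) simp
    qed
    also have "\<dots> = ?c * emeasure P C_abs"
      using emeasure_Q_hitting[OF c, of C_abs] sets.top[of "Filt_at (hitting_time ?c)"]
      by (simp add: Int_absorb1)
    also have "\<dots> = ?c" using emeasure_space_1 by (simp add: space_P)
    finally show ?thesis .
  qed
  have "(\<lambda>k. ennreal (inverse (real (Suc (Suc k))))) \<longlonglongrightarrow> ennreal 0"
    using LIMSEQ_Suc[OF LIMSEQ_inverse_real_of_nat] by (intro tendsto_ennrealI) simp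
  then have "emeasure Q ?E \<le> ennreal 0"
    by (rule LIMSEQ_le_const) (use le in auto)
  then have "?E \<in> null_sets Q" using E by (simp add: null_sets_def)
  then show ?thesis
    by (rule AE_I') (auto simp: Q.space_P)
qed

text \<open>
Since \<open>X\<^sub>\<infinity> = \<infinity>\<close> holds \<open>Q\<close>-almost surely, \<open>T\<^sub>\<infinity>\<close> is not \<open>\<TT>\<close>, and the conditioning event is \<open>{T\<^sub>c < \<TT>}\<close> with
probability \<open>c\<close>. On it \<open>1 / X\<^bsub>T\<^sub>c\<^esub> = 1 / c\<close>, off it \<open>1 / X\<^bsub>T\<^sub>c\<^esub> = 1 / \<infinity> = 0\<close>.
\<close>

lemma conditioning_density:
  assumes c: "0 < c" "c < 1"
  shows "uniform_measure Q {\<omega> \<in> space Q. hitting_time c \<omega> \<le> hitting_time \<infinity> \<omega>} =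
    density Q (\<lambda>\<omega>. 1 / X_at (hitting_time c) \<omega>)"
proof -
  have c_fin: "c \<noteq> \<infinity>" using c by auto
  let ?T = "hitting_time c"
  let ?H = "{\<omega> \<in> C_abs. ?T \<omega> < Beyond}"
  let ?B = "{\<omega> \<in> space Q. ?T \<omega> \<le> hitting_time \<infinity> \<omega>}"
  have st: "is_stopping_time ?T" by (rule stopping_time_hitting_time[OF c_fin])
  have H: "?H \<in> sets Q" unfolding Q.sets_P by (rule hitting_before_Beyond_measurable[OF c_fin])
  have "?B = ?H \<union> {\<omega> \<in> space Filt_inf. path_at_inf \<omega> \<in> - {\<infinity>}}"
    using hitting_time_le_hitting_time_inf_iff[OF _ c_fin] by (auto simp: Q.space_P)
  moreover have "{\<omega> \<in> space Filt_inf. path_at_inf \<omega> \<in> - {\<infinity>}} \<in> sets Q"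
    unfolding Q.sets_P by (intro level_sets_measurable path_at_inf_measurable) auto
  ultimately have B: "?B \<in> sets Q" using H by simp
  have BH: "AE \<omega> in Q. (\<omega> \<in> ?B \<longleftrightarrow> \<omega> \<in> ?H)"
    using Q_path_at_inf AE_space
  proof eventually_elim
    case (elim \<omega>)
    then show ?case
      using hitting_time_le_hitting_time_inf_iff[OF _ c_fin, of \<omega>] by (auto simp: Q.space_P)
  qed
  have "emeasure Q ?B = emeasure Q ?H" by (rule emeasure_eq_AE[OF BH B H])
  also have "\<dots> = c"
    using emeasure_Q_hitting[OF c, of C_abs] sets.top[of "Filt_at ?T"] emeasure_space_1
    by (simp add: Int_absorb1 space_P)
  finally have QB: "emeasure Q ?B = c" .
  have X: "X_at ?T \<in> borel_measurable Q"
    using measurable_from_subalg[OF Q.subalgebra_Filt_at[OF st] X_at_measurable[OF st]] .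
  show ?thesis
    unfolding uniform_measure_def QB
  proof (rule density_cong)
    show "AE \<omega> in Q. indicator ?B \<omega> / c = 1 / X_at ?T \<omega>"
      using BH Q_path_at_inf AE_space
    proof eventually_elim
      case (elim \<omega>)
      then have C: "\<omega> \<in> C_abs" by (simp add: Q.space_P)
      show ?case
      proof (cases "?T \<omega> < Beyond")
        case True
        then show ?thesis using elim(1) C X_at_hitting_time[OF C True] by (simp add: indicator_def)
      next
        case False
        then have "X_at ?T \<omega> = \<infinity>" using X_at_infinite[of ?T \<omega>] elim(2) by (simp add: less_Beyond_iff)
        then show ?thesis using elim(1) False by (simp add: indicator_def)
      qed
    qed
  qed (use B X in measurable)
qed

lemma P_extends: "extends_conditioned_measures Q P"
  unfolding extends_conditioned_measures_def Let_def
proof (intro conjI allI impI)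
  show "prob_space P" by (rule prob_space_axioms)
  show "sets P = sets Filt_inf" by (rule sets_P)
  fix a :: real assume a: "1 < a"
  let ?c = "ennreal (1 / a)"
  let ?T = "hitting_time ?c"
  have c: "0 < ?c" "?c < 1" using a by (auto simp: ennreal_less_one_iff)
  let ?H = "{\<omega> \<in> space Q. ?T \<omega> < Beyond}"
  have H: "?H \<in> sets Q"
    using hitting_before_Beyond_measurable[of ?c] by (simp add: Q.sets_P Q.space_P)
  have st: "is_stopping_time ?T" by (rule stopping_time_hitting_time) simp
  have QA: "emeasure Q (?H \<inter> A) = ?c * emeasure P A" if "A \<in> sets (Filt_at ?T)" for A
    using emeasure_Q_hitting[OF c that] by (simp add: Q.space_P Int_commute)
  have QH: "emeasure Q ?H = ?c"
    using QA[of C_abs] sets.top[of "Filt_at ?T"] emeasure_space_1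
    by (simp add: Q.space_P space_P Int_absorb2 subset_eq)
  have sub: "subalgebra (uniform_measure Q ?H) (Filt_at ?T)"
    using Q.subalgebra_Filt_at[OF st] by (simp add: subalgebra_def)
  show "restr_to_subalg P (Filt_at ?T) = restr_to_subalg (uniform_measure Q ?H) (Filt_at ?T)"
  proof (rule measure_eqI)
    show "sets (restr_to_subalg P (Filt_at ?T)) = sets (restr_to_subalg (uniform_measure Q ?H) (Filt_at ?T))"
      using sub subalgebra_Filt_at[OF st] by (simp add: sets_restr_to_subalg)
    fix A assume "A \<in> sets (restr_to_subalg P (Filt_at ?T))"
    then have A: "A \<in> sets (Filt_at ?T)" using subalgebra_Filt_at[OF st] by (simp add: sets_restr_to_subalg)
    then have AQ: "A \<in> sets Q" using sets_Filt_at_subset[OF st] by (auto simp: Q.sets_P)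
    have "emeasure (restr_to_subalg (uniform_measure Q ?H) (Filt_at ?T)) A = ?c * emeasure P A / ?c"
      using emeasure_restr_to_subalg[OF sub A] QA[OF A] QH H AQ by simp
    also have "\<dots> = emeasure P A"
      using c by (subst mult.commute) (simp add: mult_divide_eq_ennreal)
    finally show "emeasure (restr_to_subalg P (Filt_at ?T)) A =
        emeasure (restr_to_subalg (uniform_measure Q ?H) (Filt_at ?T)) A"
      using emeasure_restr_to_subalg[OF subalgebra_Filt_at[OF st] A] by simp
  qed
qed

end

section \<open>Measures that agree until the path vanishes\<close>

definition small_level :: "nat \<Rightarrow> ennreal" where
  "small_level n = ennreal (1 / (real n + 2))"

lemma small_level: "0 < small_level n" "small_level n < 1" "small_level (Suc n) \<le> small_level n"
    "small_level n \<noteq> \<infinity>"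
  by (auto simp: small_level_def ennreal_less_one_iff intro!: ennreal_leI divide_left_mono)

lemma small_level_tendsto: "small_level \<longlonglongrightarrow> 0"
proof -
  have "(\<lambda>n. 1 / (real n + 2)) \<longlonglongrightarrow> 0"
    using LIMSEQ_Suc[OF LIMSEQ_inverse_real_of_nat] by (simp add: field_simps)
  then show ?thesis
    unfolding small_level_def by (metis ennreal_0 tendsto_ennrealI)
qed

lemma le_all_small_levels: "(\<And>n. x \<le> small_level n) \<Longrightarrow> x = 0"
  using LIMSEQ_le_const[OF small_level_tendsto, of x] by auto

text \<open>
A path from \<open>1\<close> ceases to survive when it is absorbed in \<open>0\<close>, or when it jumps to \<open>\<infinity>\<close> after having had
the limit inferior \<open>0\<close> before the jump. A jump from values bounded away from \<open>0\<close> is survived, and so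
are all later times. The sigma-algebras up to the hitting times of the small levels carry no
information about what happens after survival.
\<close>

definition survives :: "real \<Rightarrow> path set" where
  "survives s = {\<omega> \<in> C_abs. \<omega> 0 = 1 \<and> (\<exists>n. \<not> hitting_time (small_level n) \<omega> \<le> Time (ennreal s))}"

text \<open>
The hitting times, which express that survival is an event of time \<open>s\<close>, are eliminated in favour
of the path.
\<close>

lemma survives_iff:
  assumes "\<omega> \<in> C_abs" "0 \<le> s"
  shows "\<omega> \<in> survives s \<longleftrightarrow> \<omega> 0 = 1 \<and> (\<exists>n. \<forall>u. 0 \<le> u \<longrightarrow> u \<le> s \<longrightarrow> \<omega> u \<noteq> small_level n)"
  using assms hitting_time_le_iff[OF assms] by (auto simp: survives_def)

lemma survives_antimono:
  assumes "s \<le> t"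
  shows "survives t \<subseteq> survives s"
proof -
  have "Time (ennreal s) \<le> Time (ennreal t)" using assms by (simp add: ennreal_leI)
  then show ?thesis unfolding survives_def by (blast intro: order_trans)
qed

lemma not_survives_finite:
  assumes C: "\<omega> \<in> C_abs" "\<omega> 0 = 1" and s: "0 \<le> s" "\<omega> s \<noteq> \<infinity>"
  shows "\<omega> \<notin> survives s \<longleftrightarrow> \<omega> s = 0"
proof
  assume "\<omega> \<notin> survives s"
  then have hit: "\<exists>u. 0 \<le> u \<and> u \<le> s \<and> \<omega> u = small_level n" for n
    using survives_iff[OF C(1) s(1)] C(2) by auto
  obtain v where v: "v \<in> {0..s}" "\<And>u. u \<in> {0..s} \<Longrightarrow> \<omega> v \<le> \<omega> u"
    using continuous_attains_inf[OF compact_Icc _ C_abs_continuous_on_Icc[OF C(1) s(2)]] s(1) by auto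
  have "\<omega> v \<le> small_level n" for n
    using hit[of n] v(2) by (metis atLeastAtMost_iff)
  then have "\<omega> v = 0" by (rule le_all_small_levels)
  then show "\<omega> s = 0" using C_abs_zero_absorbing[OF C(1), of v s] v(1) by simp
next
  assume 0: "\<omega> s = 0"
  have "\<exists>u. 0 \<le> u \<and> u \<le> s \<and> \<omega> u = small_level n" for n
    using C_abs_hits_between[OF C(1) s, of "small_level n"] 0 C(2) less_imp_le[OF small_level(2)]
    by (metis zero_le)
  then show "\<omega> \<notin> survives s"
    using survives_iff[OF C(1) s(1)] by auto
qed

text \<open>
The path tends to \<open>0\<close> when survival ends: for each \<open>n\<close> there is a time \<open>q\<close> at which the path still
survives and after which it stays below \<open>small_level n\<close> as long as it survives. This is expressed
at rational times and by surviving values only, so that it is an event of the sigma-algebra on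
which the hitting times of small levels determine a measure.
\<close>

definition tame :: "path set" where
  "tame = {\<omega> \<in> C_abs. \<omega> \<in> survives 0 \<and> (\<forall>s::rat. 0 \<le> s \<longrightarrow> \<omega> \<in> survives (of_rat s) \<or>
     (\<forall>n. \<exists>q::rat. 0 \<le> q \<and> q < s \<and> \<omega> \<in> survives (of_rat q) \<and>
        (\<forall>r::rat. q \<le> r \<and> r \<le> s \<longrightarrow> \<not> (\<omega> \<in> survives (of_rat r) \<and> small_level n \<le> \<omega> (of_rat r)))))}"

text \<open>
If survival has ended but the path is not at \<open>0\<close>, then the path is finite and positive until it
jumps to \<open>\<infinity>\<close>. Being tame, it has the left limit \<open>0\<close> at the jump, and such jumps are excluded by the
last clause in the definition of \<^term>\<open>C_abs\<close>.
\<close>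

lemma tame_after_survival_rat:
  assumes tame: "\<omega> \<in> tame" and s: "0 \<le> s" "\<omega> \<notin> survives (of_rat s)"
  shows "\<omega> (of_rat s) = 0"
proof (rule ccontr)
  assume nz: "\<omega> (of_rat s) \<noteq> 0"
  have C: "\<omega> \<in> C_abs" and 1: "\<omega> 0 = 1" using tame by (auto simp: tame_def survives_def)
  have s0: "0 \<le> (of_rat s :: real)" using s(1) by simp
  have "\<omega> (of_rat s) = \<infinity>"
    using not_survives_finite[OF C 1 s0] s(2) nz by auto
  then obtain t where t: "0 \<le> t" "t \<le> of_rat s" "\<omega> t = \<infinity>"
      "\<And>r. 0 \<le> r \<Longrightarrow> r < t \<Longrightarrow> \<omega> r \<noteq> \<infinity>" "0 < t \<Longrightarrow> \<not> (\<omega> \<longlongrightarrow> 0) (at_left t)"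
    using C_abs_first_inf[OF C s0] by blast
  have t0: "0 < t" using t(1,3) 1 by (cases "t = 0") auto
  have not_t: "\<omega> \<notin> survives t"
  proof
    assume "\<omega> \<in> survives t"
    then obtain n where n: "\<And>u. 0 \<le> u \<Longrightarrow> u \<le> t \<Longrightarrow> \<omega> u \<noteq> small_level n"
      using survives_iff[OF C t(1)] by auto
    have "\<omega> u \<noteq> small_level n" if "0 \<le> u" for u
    proof (cases "u \<le> t")
      case False
      then show ?thesis using C_abs_inf_absorbing[OF C t(1) _ t(3), of u] small_level(4)[of n] by auto
    qed (use n that in auto)
    then show False using s(2) survives_iff[OF C s0] 1 by auto
  qed
  have small: "\<exists>q::real. 0 \<le> q \<and> q < t \<and> (\<forall>v. q \<le> v \<longrightarrow> v < t \<longrightarrow> \<omega> v \<le> small_level n)" for n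
  proof -
    have "\<forall>n. \<exists>q::rat. 0 \<le> q \<and> q < s \<and> \<omega> \<in> survives (of_rat q) \<and>
        (\<forall>r::rat. q \<le> r \<and> r \<le> s \<longrightarrow> \<not> (\<omega> \<in> survives (of_rat r) \<and> small_level n \<le> \<omega> (of_rat r)))"
      using tame s unfolding tame_def by blast
    then obtain q :: rat where q: "0 \<le> q" "q < s" "\<omega> \<in> survives (of_rat q)"
      and below: "\<And>r::rat. q \<le> r \<Longrightarrow> r \<le> s \<Longrightarrow> \<omega> \<in> survives (of_rat r) \<Longrightarrow> \<omega> (of_rat r) < small_level n"
      by (meson not_le)
    have qt: "of_rat q < t"
      using q(3) not_t survives_antimono[of t "of_rat q"] by (meson not_le subsetD)
    have q0: "0 \<le> (of_rat q :: real)" using q(1) by simp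
    have "\<omega> v \<le> small_level n" if v: "of_rat q \<le> v" "v < t" for v
    proof (rule ccontr)
      assume "\<not> \<omega> v \<le> small_level n"
      then have "\<omega> v \<in> {small_level n<..}" by (simp add: not_le)
      then obtain d where d: "v < d" "\<And>w. v \<le> w \<Longrightarrow> w < d \<Longrightarrow> \<omega> w \<in> {small_level n<..}"
        using C_abs_stays_in_open[OF C order_trans[OF q0 v(1)] open_greaterThan] by blast
      obtain r where r: "v < of_rat r" "of_rat r < min d t"
        using of_rat_dense[of v "min d t"] d(1) v(2) by auto
      have "small_level n < \<omega> (of_rat r)" using d(2)[of "of_rat r"] r by auto
      moreover have "q \<le> r" "r \<le> s"
        using r v t(2) by (auto simp: of_rat_less_eq[where 'a = real, symmetric])
      moreover have "\<omega> \<in> survives (of_rat r)"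
      proof (rule ccontr)
        assume "\<omega> \<notin> survives (of_rat r)"
        moreover have r0: "0 \<le> (of_rat r :: real)" using r v q0 by linarith
        moreover have "\<omega> (of_rat r) \<noteq> \<infinity>" by (rule t(4)[OF r0]) (use r in simp)
        ultimately have "\<omega> (of_rat r) = 0" using not_survives_finite[OF C 1] by blast
        then show False using \<open>small_level n < \<omega> (of_rat r)\<close> by simp
      qed
      ultimately show False using below[of r] by auto
    qed
    then show ?thesis using qt q0 by blast
  qed
  have "(\<omega> \<longlongrightarrow> 0) (at_left t)"
  proof (rule order_tendstoI)
    fix y :: ennreal assume "0 < y"
    then obtain n where n: "small_level n < y"
      using order_tendstoD(2)[OF small_level_tendsto] by (auto simp: eventually_sequentially)
    obtain q where "0 \<le> q" "q < t" "\<And>v. q \<le> v \<Longrightarrow> v < t \<Longrightarrow> \<omega> v \<le> small_level n"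
      using small[of n] by blast
    then show "\<forall>\<^sub>F v in at_left t. \<omega> v < y"
      using n unfolding eventually_at_left_field by (meson less_imp_le order.strict_trans1)
  qed simp
  then show False using t(5) t0 by blast
qed

lemma tame_after_survival:
  assumes tame: "\<omega> \<in> tame" and s: "0 \<le> s" "\<omega> \<notin> survives s"
  shows "\<omega> s = 0"
proof (rule ccontr)
  assume "\<omega> s \<noteq> 0"
  have C: "\<omega> \<in> C_abs" using tame by (simp add: tame_def)
  obtain d where d: "s < d" "\<And>w. s \<le> w \<Longrightarrow> w < d \<Longrightarrow> \<omega> w \<in> - {0}"
    using C_abs_stays_in_open[OF C s(1), of "- {0}"] \<open>\<omega> s \<noteq> 0\<close> by auto
  obtain q where q: "s < of_rat q" "of_rat q < d" using of_rat_dense[OF d(1)] by blast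
  have "\<omega> \<notin> survives (of_rat q)" using survives_antimono[of s "of_rat q"] q s(2) by auto
  moreover have "0 \<le> q"
    using q(1) s(1) by (metis less_le_trans not_le of_rat_less_0_iff order_less_asym)
  ultimately have "\<omega> (of_rat q) = 0" using tame_after_survival_rat[OF tame] by blast
  then show False using d(2)[of "of_rat q"] q by auto
qed

text \<open>
For a finite path survival ends when \<open>0\<close> is reached, and it is reached continuously.
\<close>

lemma finite_path_tame:
  assumes C: "\<omega> \<in> C_abs" and 1: "\<omega> 0 = 1" and fin: "\<And>t. 0 \<le> t \<Longrightarrow> \<omega> t \<noteq> \<infinity>"
  shows "\<omega> \<in> tame"
proof -
  have surv: "\<omega> \<in> survives t \<longleftrightarrow> \<omega> t \<noteq> 0" if "0 \<le> t" for t
    using not_survives_finite[OF C 1 that fin[OF that]] by auto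
  have "\<exists>q::rat. 0 \<le> q \<and> q < s \<and> \<omega> \<in> survives (of_rat q) \<and>
      (\<forall>r::rat. q \<le> r \<and> r \<le> s \<longrightarrow> \<not> (\<omega> \<in> survives (of_rat r) \<and> small_level n \<le> \<omega> (of_rat r)))"
    if s: "0 \<le> s" "\<omega> \<notin> survives (of_rat s)" for s :: rat and n
  proof -
    have s0: "0 \<le> (of_rat s :: real)" using s(1) by simp
    have zs: "\<omega> (of_rat s) = 0" using surv[OF s0] s(2) by simp
    then have "hitting_time 0 \<omega> \<le> Time (ennreal (of_rat s))"
      using hitting_time_le_iff[OF C s0, of 0] s0 by (auto intro!: exI[of _ "of_rat s"])
    then obtain v where v: "hitting_time 0 \<omega> = Time v" "v \<le> ennreal (of_rat s)"
      by (cases "hitting_time 0 \<omega>") auto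
    then obtain t where t: "0 \<le> t" "v = ennreal t" by (cases v) (auto simp: top_unique)
    have ts: "t \<le> of_rat s" using v(2) t s0 by simp
    have zt: "\<omega> t = 0" using C_abs_first_hit[OF C t(1)] v t by simp
    have t0: "0 < t" using t(1) zt 1 by (cases "t = 0") auto
    have before: "\<omega> r \<noteq> 0" if "0 \<le> r" "r < t" for r
    proof
      assume "\<omega> r = 0"
      then have "hitting_time 0 \<omega> \<le> Time (ennreal r)"
        using hitting_time_le_iff[OF C that(1)] that by auto
      then show False using v t that by simp
    qed
    have "(\<omega> \<longlongrightarrow> \<omega> t) (at_left t)"
      using continuous_on_Icc_at_leftD[OF C_abs_continuous_on_Icc[OF C fin[OF t(1)]] t0] .
    then have "\<forall>\<^sub>F w in at_left t. \<omega> w < small_level n"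
      using zt small_level(1)[of n] by (intro order_tendstoD(2)) auto
    then obtain b where b: "b < t" "\<And>w. b < w \<Longrightarrow> w < t \<Longrightarrow> \<omega> w < small_level n"
      unfolding eventually_at_left_field by blast
    obtain q where q: "max b 0 < of_rat q" "of_rat q < t"
      using of_rat_dense[of "max b 0" t] b(1) t0 by auto
    have q0: "0 \<le> (of_rat q :: real)" using q by simp
    have "\<not> (\<omega> \<in> survives (of_rat r) \<and> small_level n \<le> \<omega> (of_rat r))" if r: "q \<le> r" for r
    proof (cases "of_rat r < t")
      case True
      have "b < of_rat r"
        using q(1) r by (metis max_less_iff_conj of_rat_less_eq order.strict_trans2)
      then show ?thesis using b(2) True by (simp add: not_le)
    next
      case False
      then have "\<omega> (of_rat r) = 0" using C_abs_zero_absorbing[OF C t(1) _ zt] by simp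
      then show ?thesis using small_level(1)[of n] by auto
    qed
    moreover have "0 \<le> q" using q0 by simp
    moreover have "q < s"
      using q(2) ts by (metis of_rat_less order.strict_trans2)
    moreover have "\<omega> \<in> survives (of_rat q)" using surv[OF q0] before[OF q0 q(2)] by simp
    ultimately show ?thesis by blast
  qed
  moreover have "\<omega> \<in> survives 0" using surv[of 0] 1 by simp
  ultimately show ?thesis using C by (auto simp: tame_def)
qed

text \<open>
The intersection of two of the events \<open>A \<inter> survives s\<close> is again of this form, because survival is
monotone in time.
\<close>

definition survival_family :: "path set set" where
  "survival_family = insert C_abs {A \<inter> survives s | s A. 0 \<le> s \<and> A \<in> sets (Filt s)}"

lemma survival_family_sub: "survival_family \<subseteq> Pow C_abs"
  by (auto simp: survival_family_def survives_def)

lemma Int_stable_survival_family: "Int_stable survival_family"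
proof (rule Int_stableI)
  fix A B assume "A \<in> survival_family" "B \<in> survival_family"
  then consider "A = C_abs" | "B = C_abs"
    | s A' r B' where "A = A' \<inter> survives s" "0 \<le> s" "A' \<in> sets (Filt s)"
        "B = B' \<inter> survives r" "0 \<le> r" "B' \<in> sets (Filt r)"
    unfolding survival_family_def by blast
  then show "A \<inter> B \<in> survival_family"
  proof cases
    case 1
    then have "A \<inter> B = B" using survival_family_sub \<open>B \<in> survival_family\<close> by auto
    then show ?thesis using \<open>B \<in> survival_family\<close> by simp
  next
    case 2
    then have "A \<inter> B = A" using survival_family_sub \<open>A \<in> survival_family\<close> by auto
    then show ?thesis using \<open>A \<in> survival_family\<close> by simp
  next
    case 3
    have "survives s \<inter> survives r = survives (max s r)"
      using survives_antimono[of s r] survives_antimono[of r s] by (auto simp: max_def)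
    then have "A \<inter> B = (A' \<inter> B') \<inter> survives (max s r)" using 3 by blast
    moreover have "A' \<inter> B' \<in> sets (Filt (max s r))"
      using 3 sets_Filt_mono[of s "max s r"] sets_Filt_mono[of r "max s r"] by auto
    ultimately show ?thesis using 3(2) unfolding survival_family_def by fastforce
  qed
qed

text \<open>
An event of time \<open>s\<close> on which \<open>\<tau>\<close> has not yet occurred belongs to the past of \<open>\<tau>\<close>: for \<open>t \<le> s\<close> its
intersection with \<open>{\<tau> \<le> t}\<close> is empty.
\<close>

lemma Filt_minus_hitting:
  assumes \<tau>: "is_stopping_time \<tau>" and s: "0 \<le> s" and A: "A \<in> sets (Filt s)"
  shows "A - {\<omega> \<in> C_abs. \<tau> \<omega> \<le> Time (ennreal s)} \<in> sets (Filt_at \<tau>)"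
proof -
  let ?S = "\<lambda>t. {\<omega> \<in> C_abs. \<tau> \<omega> \<le> Time (ennreal t)}"
  have S: "?S t \<in> sets (Filt t)" if "0 \<le> t" for t
    using \<tau> that by (simp add: is_stopping_time_def)
  have AS: "A - ?S s \<in> sets (Filt s)" using A S[OF s] by blast
  have "(A - ?S s) \<inter> ?S t \<in> sets (Filt t)" if t: "0 \<le> t" for t
  proof (cases "t \<le> s")
    case True
    then have "Time (ennreal t) \<le> Time (ennreal s)" by (simp add: ennreal_leI)
    then have "(A - ?S s) \<inter> ?S t = {}" by (auto intro: order_trans)
    then show ?thesis by simp
  next
    case False
    then show ?thesis using AS S[OF t] sets_Filt_mono[of s t] by auto
  qed
  then show ?thesis
    unfolding sets_Filt_at_iff[OF \<tau>] using AS sets_Filt_subset[OF s] by blast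
qed

definition survival_algebra :: "path measure" where
  "survival_algebra = sigma C_abs survival_family"

lemma space_survival_algebra [simp]: "space survival_algebra = C_abs"
  by (simp add: survival_algebra_def space_measure_of_conv)

lemma sets_survival_algebra: "sets survival_algebra = sigma_sets C_abs survival_family"
  unfolding survival_algebra_def using survival_family_sub by simp

lemma survival_sets:
  assumes "0 \<le> s" "A \<in> sets (Filt s)"
  shows "A \<inter> survives s \<in> sets survival_algebra"
  unfolding sets_survival_algebra
  by (rule sigma_sets.Basic) (use assms in \<open>auto simp: survival_family_def\<close>)

lemma survival_value_sets:
  assumes s: "0 \<le> s" and B: "B \<in> sets borel"
  shows "{\<omega> \<in> C_abs. \<omega> \<in> survives s \<and> \<omega> s \<in> B} \<in> sets survival_algebra"
proof -
  have "{\<omega> \<in> C_abs. \<omega> \<in> survives s \<and> \<omega> s \<in> B} = {\<omega> \<in> space (Filt s). \<omega> s \<in> B} \<inter> survives s"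
    by auto
  then show ?thesis
    using survival_sets[OF s level_sets_measurable[OF eval_measurable_Filt[OF s order_refl] B]] by simp
qed

lemma tame_measurable: "tame \<in> sets survival_algebra"
proof -
  have surv: "{\<omega> \<in> C_abs. \<omega> \<in> survives s} \<in> sets survival_algebra" if "0 \<le> s" for s
    using survival_value_sets[OF that, of UNIV] by simp
  have val: "{\<omega> \<in> C_abs. \<omega> \<in> survives s \<and> c \<le> \<omega> s} \<in> sets survival_algebra" if "0 \<le> s" for s c
    using survival_value_sets[OF that, of "{c..}"] by simp
  have pred_surv: "Measurable.pred survival_algebra (\<lambda>\<omega>. \<omega> \<in> survives (of_rat s))" if "0 \<le> s" for s :: rat
    using surv[of "of_rat s"] that by (simp add: pred_def)
  have pred_val: "Measurable.pred survival_algebra (\<lambda>\<omega>. \<omega> \<in> survives (of_rat s) \<and> small_level n \<le> \<omega> (of_rat s))"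
    if "0 \<le> s" for s :: rat and n
    using val[of "of_rat s"] that by (simp add: pred_def)
  have window: "Measurable.pred survival_algebra (\<lambda>\<omega>. \<forall>r::rat. q \<le> r \<and> r \<le> s \<longrightarrow>
      \<not> (\<omega> \<in> survives (of_rat r) \<and> small_level n \<le> \<omega> (of_rat r)))" if "0 \<le> q" for q s :: rat and n
    by (rule pred_intros_countable(1), rule pred_intros_imp', rule pred_intros_logic(2), rule pred_val)
      (use that in auto)
  have entry: "Measurable.pred survival_algebra (\<lambda>\<omega>. \<exists>q::rat. 0 \<le> q \<and> q < s \<and> \<omega> \<in> survives (of_rat q) \<and>
      (\<forall>r::rat. q \<le> r \<and> r \<le> s \<longrightarrow> \<not> (\<omega> \<in> survives (of_rat r) \<and> small_level n \<le> \<omega> (of_rat r))))"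
    for s :: rat and n
    by (rule pred_intros_countable(2), rule pred_intros_conj1', rule pred_intros_conj1',
        rule pred_intros_logic(3), erule pred_surv, erule window)
  have start: "Measurable.pred survival_algebra (\<lambda>\<omega>. \<omega> \<in> survives 0)"
    using surv[of 0] by (simp add: pred_def)
  have "Measurable.pred survival_algebra (\<lambda>\<omega>. \<omega> \<in> survives 0 \<and>
      (\<forall>s::rat. 0 \<le> s \<longrightarrow> \<omega> \<in> survives (of_rat s) \<or>
     (\<forall>n. \<exists>q::rat. 0 \<le> q \<and> q < s \<and> \<omega> \<in> survives (of_rat q) \<and>
        (\<forall>r::rat. q \<le> r \<and> r \<le> s \<longrightarrow> \<not> (\<omega> \<in> survives (of_rat r) \<and> small_level n \<le> \<omega> (of_rat r))))))"
    by (rule pred_intros_logic(3)[OF start], intro pred_intros_countable(1) pred_intros_imp',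
        rule pred_intros_logic(5), erule pred_surv, intro pred_intros_countable(1) entry)
  then show ?thesis
    unfolding tame_def pred_def by simp
qed

text \<open>
On tame paths \<open>X\<^sub>s\<close> is its surviving value, or \<open>0\<close> if the path does not survive \<open>s\<close>. So it is
measurable with respect to the surviving values.
\<close>

lemma tame_trace:
  assumes A: "A \<in> sets Filt_inf"
  shows "A \<inter> tame \<in> sets survival_algebra"
proof -
  let ?S = "restrict_space survival_algebra tame"
  have tame_C: "tame \<subseteq> C_abs" by (auto simp: tame_def)
  then have space_S: "space ?S = tame" by (simp add: space_restrict_space Int_absorb2)
  have sets_S: "B \<in> sets ?S \<longleftrightarrow> B \<subseteq> tame \<and> B \<in> sets survival_algebra" for B
    using tame_measurable tame_C by (intro sets_restrict_space_iff) (simp add: Int_absorb2)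
  have Filt: "(\<lambda>\<omega>. \<omega>) \<in> measurable ?S (Filt t)" for t
    unfolding Filt_def
  proof (rule measurable_measure_of[OF Filt_gen_sub])
    fix Y assume "Y \<in> {X (ennreal s) -` B \<inter> C_abs | s B. 0 \<le> s \<and> s \<le> t \<and> B \<in> sets borel}"
    then obtain s B where s: "0 \<le> s" and B: "B \<in> sets borel" and Y: "Y = X (ennreal s) -` B \<inter> C_abs"
      by auto
    let ?V = "{\<omega> \<in> C_abs. \<omega> \<in> survives s \<and> \<omega> s \<in> B}"
    let ?W = "{\<omega> \<in> C_abs. \<omega> \<in> survives s \<and> \<omega> s \<in> UNIV}"
    note VW = survival_value_sets[OF s B] survival_value_sets[OF s, of UNIV]
    have "Y \<inter> tame = tame \<inter> (if 0 \<in> B then ?V \<union> (tame - ?W) else ?V)"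
    proof (rule set_eqI)
      fix \<omega>
      show "\<omega> \<in> Y \<inter> tame \<longleftrightarrow> \<omega> \<in> tame \<inter> (if 0 \<in> B then ?V \<union> (tame - ?W) else ?V)"
        using tame_after_survival[OF _ s, of \<omega>] tame_C
        by (cases "\<omega> \<in> survives s") (auto simp: Y X_ennreal[OF s])
    qed
    also have "\<dots> \<in> sets survival_algebra"
      using VW tame_measurable by auto
    finally show "(\<lambda>\<omega>. \<omega>) -` Y \<inter> space ?S \<in> sets ?S"
      unfolding sets_S space_S by simp
  qed (use tame_C space_S in auto)
  have "(\<lambda>\<omega>. \<omega>) \<in> measurable ?S Filt_inf"
    unfolding Filt_inf_def
  proof (rule measurable_measure_of)
    show "(\<Union>t\<in>{0..}. sets (Filt t)) \<subseteq> Pow C_abs"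
      using sets.space_closed[of "Filt _"] by auto
    fix Y assume "Y \<in> (\<Union>t\<in>{0..}. sets (Filt t))"
    then show "(\<lambda>\<omega>. \<omega>) -` Y \<inter> space ?S \<in> sets ?S"
      using measurable_sets[OF Filt] by auto
  qed (use tame_C space_S in auto)
  from measurable_sets[OF this A] show ?thesis
    unfolding sets_S space_S by simp
qed

text \<open>
On a set \<open>A \<inter> survives s\<close> the two measures agree, since it is the increasing union over \<open>n\<close> of
events \<open>A \<inter> {X\<^sub>0 = 1, s < T}\<close> with \<open>T\<close> the hitting time of \<open>small_level n\<close>, which belong to the past of
\<open>T\<close>; it increases because a path from \<open>1\<close> crosses each level before the lower ones. These sets are
stable under intersection, so the measures agree on the sigma-algebra they generate. As \<^term>\<open>tame\<close>
belongs to it and has full measure under \<open>P\<close>, it has full measure under \<open>R\<close>, and on tame paths the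
generated sigma-algebra is everything.
\<close>

lemma measure_determined_before_vanishing:
  assumes P: "path_prob_space P" and R: "path_prob_space R"
    and tame: "AE \<omega> in P. \<omega> \<in> tame"
    and agree: "\<And>n A. A \<in> sets (Filt_at (hitting_time (small_level n))) \<Longrightarrow> emeasure R A = emeasure P A"
  shows "R = P"
proof -
  interpret P: path_prob_space P by (rule P)
  interpret R: path_prob_space R by (rule R)
  have st: "is_stopping_time (hitting_time (small_level n))" for n
    using small_level(4) by (rule stopping_time_hitting_time)
  have agree_family: "emeasure R A = emeasure P A" if "A \<in> survival_family" for A
  proof (cases "A = C_abs")
    case True
    then show ?thesis
      using P.emeasure_space_1 R.emeasure_space_1 by (simp add: P.space_P R.space_P)
  next
    case False
    then have "\<exists>s B. A = B \<inter> survives s \<and> 0 \<le> s \<and> B \<in> sets (Filt s)"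
      using that unfolding survival_family_def by simp
    then obtain s B where s: "0 \<le> s" and B: "B \<in> sets (Filt s)" and A: "A = B \<inter> survives s"
      by blast
    let ?N = "{\<omega> \<in> space (Filt s). \<omega> 0 \<in> {1}}"
    let ?S = "\<lambda>n. {\<omega> \<in> C_abs. hitting_time (small_level n) \<omega> \<le> Time (ennreal s)}"
    define E where "E n = (B \<inter> ?N) - ?S n" for n
    have "B \<inter> ?N \<in> sets (Filt s)"
      by (intro sets.Int B level_sets_measurable eval_measurable_Filt s) auto
    then have E: "E n \<in> sets (Filt_at (hitting_time (small_level n)))" for n
      unfolding E_def by (intro Filt_minus_hitting st s)
    then have E_inf: "E n \<in> sets Filt_inf" for n
      using sets_Filt_at_subset[OF st] by blast
    have inc: "incseq E"
    proof (rule incseq_SucI)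
      fix n
      show "E n \<subseteq> E (Suc n)"
      proof
        fix \<omega> assume \<omega>: "\<omega> \<in> E n"
        then have C: "\<omega> \<in> C_abs" and 1: "\<omega> 0 = 1" by (auto simp: E_def)
        have "\<not> hitting_time (small_level (Suc n)) \<omega> \<le> Time (ennreal s)"
        proof
          assume "hitting_time (small_level (Suc n)) \<omega> \<le> Time (ennreal s)"
          then obtain u where u: "0 \<le> u" "u \<le> s" "\<omega> u = small_level (Suc n)"
            using hitting_time_le_iff[OF C s] by blast
          obtain v where "0 \<le> v" "v \<le> u" "\<omega> v = small_level n"
            by (rule C_abs_hits_between[OF C u(1), of "small_level n"])
              (use u 1 small_level[of n] small_level(4)[of "Suc n"] in \<open>auto intro: less_imp_le\<close>)
          then have "hitting_time (small_level n) \<omega> \<le> Time (ennreal s)"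
            using hitting_time_le_iff[OF C s, of "small_level n"] u(2) by auto
          then show False using \<omega> C by (simp add: E_def)
        qed
        then show "\<omega> \<in> E (Suc n)" using \<omega> by (simp add: E_def)
      qed
    qed
    have AE: "A = (\<Union>n. E n)"
      using sets.sets_into_space[OF B] by (auto simp: A E_def survives_def)
    have "emeasure R A = (SUP n. emeasure R (E n))"
      unfolding AE using E_inf inc by (intro SUP_emeasure_incseq[symmetric]) (auto simp: R.sets_P)
    also have "\<dots> = (SUP n. emeasure P (E n))" by (simp add: agree[OF E])
    also have "\<dots> = emeasure P A"
      unfolding AE using E_inf inc by (intro SUP_emeasure_incseq) (auto simp: P.sets_P)
    finally show ?thesis .
  qed
  have family_inf: "survival_family \<subseteq> sets Filt_inf"
  proof
    fix A assume "A \<in> survival_family"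
    then consider "A = C_abs" | s B where "0 \<le> s" "B \<in> sets (Filt s)" "A = B \<inter> survives s"
      unfolding survival_family_def by blast
    then show "A \<in> sets Filt_inf"
    proof cases
      case 1
      then show ?thesis using sets.top[of Filt_inf] by simp
    next
      case (2 s B)
      have "survives s = (\<Union>n. {\<omega> \<in> space (Filt s). \<omega> 0 \<in> {1}} -
          {\<omega> \<in> C_abs. hitting_time (small_level n) \<omega> \<le> Time (ennreal s)})"
        by (auto simp: survives_def)
      also have "\<dots> \<in> sets (Filt s)"
        using st 2(1)
        by (intro sets.countable_UN image_subsetI sets.Diff level_sets_measurable eval_measurable_Filt)
          (auto simp: is_stopping_time_def)
      finally show ?thesis
        using 2 sets_Filt_subset[of s] by blast
    qed
  qed
  have sub_inf: "sets survival_algebra \<subseteq> sets Filt_inf"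
    unfolding sets_survival_algebra using family_inf sets.sigma_sets_subset[of survival_family Filt_inf] by simp
  have subalg: "subalgebra P survival_algebra" "subalgebra R survival_algebra"
    using sub_inf by (simp_all add: subalgebra_def P.space_P R.space_P P.sets_P R.sets_P)
  have "restr_to_subalg R survival_algebra = restr_to_subalg P survival_algebra"
  proof (rule measure_eqI_generator_eq[OF Int_stable_survival_family survival_family_sub, where A = "\<lambda>_. C_abs"])
    fix A assume A: "A \<in> survival_family"
    then have "A \<in> sets survival_algebra" unfolding sets_survival_algebra by (rule sigma_sets.Basic)
    then show "emeasure (restr_to_subalg R survival_algebra) A = emeasure (restr_to_subalg P survival_algebra) A"
      using agree_family[OF A] by (simp add: emeasure_restr_to_subalg subalg)
  next
    have "emeasure (restr_to_subalg R survival_algebra) C_abs = emeasure R C_abs"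
      using sets.top[of survival_algebra] by (simp add: emeasure_restr_to_subalg subalg)
    then show "emeasure (restr_to_subalg R survival_algebra) C_abs \<noteq> \<infinity>"
      using R.emeasure_space_1 by (simp add: R.space_P)
  qed (auto simp: sets_restr_to_subalg subalg sets_survival_algebra survival_family_def)
  then have agree_algebra: "emeasure R A = emeasure P A" if "A \<in> sets survival_algebra" for A
    using emeasure_restr_to_subalg[OF subalg(1) that] emeasure_restr_to_subalg[OF subalg(2) that] by simp
  have tame_inf: "tame \<in> sets Filt_inf" using tame_measurable sub_inf by blast
  have "emeasure P tame = 1"
    using P.emeasure_eq_1_AE[OF _ tame] tame_inf by (simp add: P.sets_P)
  then have "emeasure R tame = 1" using agree_algebra[OF tame_measurable] by simp
  then have tame_R: "AE \<omega> in R. \<omega> \<in> tame"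
    using R.AE_in_set_eq_1[of tame] tame_inf by (simp add: R.sets_P R.emeasure_eq_measure)
  show ?thesis
  proof (rule measure_eqI)
    show "sets R = sets P" by (simp add: P.sets_P R.sets_P)
    fix A assume A: "A \<in> sets R"
    then have A_inf: "A \<in> sets Filt_inf" by (simp add: R.sets_P)
    have "emeasure R A = emeasure R (A \<inter> tame)"
      using tame_R A A_inf tame_inf by (intro emeasure_eq_AE) (auto simp: R.sets_P)
    also have "\<dots> = emeasure P (A \<inter> tame)"
      by (rule agree_algebra[OF tame_trace[OF A_inf]])
    also have "\<dots> = emeasure P A"
      using tame A_inf tame_inf by (intro emeasure_eq_AE) (auto simp: P.sets_P)
    finally show "emeasure R A = emeasure P A" .
  qed
qed

section \<open>The conditioned measures determine the original one\<close>

lemma (in Foellmer_pair) extension_unique: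
  assumes R: "extends_conditioned_measures Q R"
  shows "R = P"
proof (rule measure_determined_before_vanishing)
  show R': "path_prob_space R"
    using R by (auto simp: extends_conditioned_measures_def path_prob_space_def path_prob_space_axioms_def)
  interpret R: path_prob_space R by (rule R')
  show "path_prob_space P" by unfold_locales
  show "AE \<omega> in P. \<omega> \<in> tame"
    using AE_good by eventually_elim (blast intro: finite_path_tame)
  fix n A assume A: "A \<in> sets (Filt_at (hitting_time (small_level n)))"
  have st: "is_stopping_time (hitting_time (small_level n))"
    using small_level(4) by (rule stopping_time_hitting_time)
  have "1 < real n + 2" by simp
  then have "restr_to_subalg R (Filt_at (hitting_time (small_level n))) =
      restr_to_subalg P (Filt_at (hitting_time (small_level n)))"
    using R P_extends unfolding extends_conditioned_measures_def Let_def small_level_def by metis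
  then show "emeasure R A = emeasure P A"
    using emeasure_restr_to_subalg[OF R.subalgebra_Filt_at[OF st] A]
      emeasure_restr_to_subalg[OF subalgebra_Filt_at[OF st] A] by simp
qed

theorem theorem2p7:
  fixes P Q :: "path measure" and b :: real
  assumes P: "prob_space P" "sets P = sets Filt_inf"
    and X: "X_is_local_martingale P"
    and X0: "measure P {\<omega> \<in> space P. X 0 \<omega> = 1} = 1"
    and Q: "is_Foellmer_measure P Q"
    and b: "b = measure P {\<omega> \<in> space P. hitting_time 0 \<omega> = Beyond}"
    and b0: "b = 0"
  shows "(\<forall>a::real. 1 < a \<longrightarrow>
            (let T = hitting_time (ennreal (1 / a))
             in uniform_measure Q {\<omega> \<in> space Q. T \<omega> \<le> hitting_time \<infinity> \<omega>}
                = density Q (\<lambda>\<omega>. 1 / X_at T \<omega>)))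
       \<and> (\<exists>!R. extends_conditioned_measures Q R)
       \<and> (\<forall>R. extends_conditioned_measures Q R \<longrightarrow> R = P)"
proof -
  interpret P: path_prob_space P
    using P by (simp add: path_prob_space_def path_prob_space_axioms_def)
  have "{\<omega> \<in> space P. X 0 \<omega> = 1} \<in> sets P"
    using level_sets_measurable[OF eval_measurable_Filt_inf[of 0], of "{1}"]
    by (simp add: P.space_P P.sets_P X_def)
  then have start: "AE \<omega> in P. \<omega> 0 = 1"
    using P.AE_prob_1[OF X0] by (auto simp: X_def)
  have "{\<omega> \<in> space P. hitting_time 0 \<omega> = Beyond} = C_abs - {\<omega> \<in> C_abs. hitting_time 0 \<omega> < Beyond}"
    by (auto simp: P.space_P less_Beyond_iff)
  then have "{\<omega> \<in> space P. hitting_time 0 \<omega> = Beyond} \<in> sets P"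
    using hitting_before_Beyond_measurable[of 0] sets.compl_sets[of _ Filt_inf] by (simp add: P.sets_P)
  then have "AE \<omega> in P. \<not> hitting_time 0 \<omega> = Beyond"
    using b b0 by (subst AE_iff_measurable[OF _ refl]) (simp_all add: P.emeasure_eq_measure)
  then have vanishing: "AE \<omega> in P. path_at_inf \<omega> = 0"
    using AE_space
    by eventually_elim (auto simp: P.space_P hitting_time_0_eq_Beyond_iff X_def)
  interpret Foellmer_pair P Q
    by unfold_locales (fact X start vanishing Q)+
  have "uniform_measure Q {\<omega> \<in> space Q. hitting_time (ennreal (1 / a)) \<omega> \<le> hitting_time \<infinity> \<omega>} =
      density Q (\<lambda>\<omega>. 1 / X_at (hitting_time (ennreal (1 / a))) \<omega>)" if "1 < a" for a :: real
    by (rule conditioning_density) (use that in \<open>auto simp: ennreal_less_one_iff\<close>)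
  then show ?thesis
    using P_extends extension_unique by (auto simp: Let_def)
qed

end
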